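(* Let $d\geq 2$ and let $(a_n)_{n\geq1}$ satisfy $0<a_{n+1}\leq a_n<1$ for all $n\geq1$. For each $n\geq 1$ let \[ F_n(z,w)=\big(z^d+q_n(z)+\delta_n w,\ \delta_n z\big), \] where $\delta_n\neq 0$, $q_n$ is a polynomial with $1\leq\deg q_n\leq d-1$, and the moduli of all coefficients of $q_n$ and $|\delta_n|$ are bounded by $a_n^{d^n}$. Then the non-autonomous basin of attraction \[ \Omega=\{(z,w)\in\mathbb{C}^2: F_n\circ\cdots\circ F_1(z,w)\to 0 \text{ as } n\to\infty\} \] is a Loewner Short $\mathbb{C}^2$.
   Context: Definition (Short $\mathbb{C}^k$): for $k\geq 2$, a domain $\Omega\subseteq\mathbb{C}^k$ is a Short $\mathbb{C}^k$ if it is the union of an increasing sequence of domains each biholomorphic to the unit ball of $\mathbb{C}^k$, its Kobayashi–Royden infinitesimal pseudometric vanishes identically, and it carries a non-constant plurisubharmonic function bounded above. Definition (Loewner): a Short $\mathbb{C}^k$ $\Omega$ is Loewner if there is a family of domains $\{\Omega_t\}_{t\geq0}$ with: (1) $\Omega=\bigcup_{t\geq0}\Omega_t$, and either every $\Omega_t$ is biholomorphic to the unit ball of $\mathbb{C}^k$ or every $\Omega_t$ is biholomorphic to the unit polydisc of $\mathbb{C}^k$; (2) $\Omega_t\subset\subset\Omega_s$ whenever $0\leq t<s$; (3) $\Omega_t=\bigcup_{t'<t}\Omega_{t'}$ for all $t>0$; (4) $\overline{\Omega_{t'}}=\bigcap_{t>t'}\Omega_t$ for all $t'\geq 0$. 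*)

theory Defs
  imports "HOL-Analysis.Analysis" "HOL-Computational_Algebra.Polynomial"
begin

type_synonym c2 = "complex \<times> complex"

definition cmul :: "complex \<Rightarrow> c2 \<Rightarrow> c2" where
  "cmul c p = (c * fst p, c * snd p)"

definition domain2 :: "c2 set \<Rightarrow> bool" where
  "domain2 U \<longleftrightarrow> open U \<and> connected U \<and> U \<noteq> {}"

definition holo2_on :: "(c2 \<Rightarrow> c2) \<Rightarrow> c2 set \<Rightarrow> bool" where
  "holo2_on f U \<longleftrightarrow> (\<forall>p\<in>U. \<exists>L. (f has_derivative L) (at p) \<and>
       (\<forall>c v. L (cmul c v) = cmul c (L v)))"

definition biholomorphic2 :: "c2 set \<Rightarrow> c2 set \<Rightarrow> bool" where
  "biholomorphic2 U V \<longleftrightarrow> (\<exists>f g. holo2_on f U \<and> holo2_on g V \<and> f ` U = V \<and> g ` V = U \<and>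
       (\<forall>x\<in>U. g (f x) = x) \<and> (\<forall>y\<in>V. f (g y) = y))"

definition unit_ball2 :: "c2 set" where
  "unit_ball2 = ball 0 1"

definition unit_polydisc2 :: "c2 set" where
  "unit_polydisc2 = {p. norm (fst p) < 1 \<and> norm (snd p) < 1}"

definition hol_disc :: "(complex \<Rightarrow> c2) \<Rightarrow> bool" where
  "hol_disc \<phi> \<longleftrightarrow> (\<lambda>\<zeta>. fst (\<phi> \<zeta>)) holomorphic_on ball 0 1 \<and> (\<lambda>\<zeta>. snd (\<phi> \<zeta>)) holomorphic_on ball 0 1"

definition disc_deriv0 :: "(complex \<Rightarrow> c2) \<Rightarrow> c2" where
  "disc_deriv0 \<phi> = (deriv (\<lambda>\<zeta>. fst (\<phi> \<zeta>)) 0, deriv (\<lambda>\<zeta>. snd (\<phi> \<zeta>)) 0)"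

definition kobayashi_royden :: "c2 set \<Rightarrow> c2 \<Rightarrow> c2 \<Rightarrow> real" where
  "kobayashi_royden \<Omega> p v = Inf {norm \<alpha> | \<alpha> \<phi>. hol_disc \<phi> \<and> \<phi> ` ball 0 1 \<subseteq> \<Omega> \<and>
       \<phi> 0 = p \<and> cmul \<alpha> (disc_deriv0 \<phi>) = v}"

text \<open>Plurisubharmonic functions with values in [-infinity, infinity): upper semicontinuous
  and satisfying the sub-mean value inequality on every closed complex disc in U.  The
  (possibly -infinity) mean value is expressed via truncations from below: u a is at most
  the circle mean of u iff it is at most the circle mean of max u c for every real c
  (monotone convergence).\<close>
definition psh2 :: "c2 set \<Rightarrow> (c2 \<Rightarrow> ereal) \<Rightarrow> bool" where
  "psh2 U u \<longleftrightarrow>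
     (\<forall>x\<in>U. u x < \<infinity>) \<and>
     (\<forall>c::real. openin (top_of_set U) {x\<in>U. u x < ereal c}) \<and>
     (\<forall>a b. (\<forall>\<zeta>. norm \<zeta> \<le> 1 \<longrightarrow> a + cmul \<zeta> b \<in> U) \<longrightarrow>
        (\<forall>c::real. u a \<le> ereal ((1 / (2 * pi)) *
            integral {0..2*pi} (\<lambda>\<theta>. real_of_ereal (max (u (a + cmul (cis \<theta>) b)) (ereal c))))))"

definition short_C2 :: "c2 set \<Rightarrow> bool" where
  "short_C2 \<Omega> \<longleftrightarrow>
     (\<exists>D :: nat \<Rightarrow> c2 set. (\<forall>n. domain2 (D n) \<and> biholomorphic2 (D n) unit_ball2 \<and> D n \<subseteq> D (Suc n))
        \<and> \<Omega> = (\<Union>n. D n)) \<and>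
     (\<forall>p\<in>\<Omega>. \<forall>v. kobayashi_royden \<Omega> p v = 0) \<and>
     (\<exists>u. psh2 \<Omega> u \<and> (\<exists>x\<in>\<Omega>. \<exists>y\<in>\<Omega>. u x \<noteq> u y) \<and> (\<exists>M::real. \<forall>x\<in>\<Omega>. u x \<le> ereal M))"

definition loewner_short_C2 :: "c2 set \<Rightarrow> bool" where
  "loewner_short_C2 \<Omega> \<longleftrightarrow> short_C2 \<Omega> \<and>
     (\<exists>W :: real \<Rightarrow> c2 set.
        (\<forall>t\<ge>0. domain2 (W t)) \<and>
        \<Omega> = (\<Union>t\<in>{0..}. W t) \<and>
        ((\<forall>t\<ge>0. biholomorphic2 (W t) unit_ball2) \<or> (\<forall>t\<ge>0. biholomorphic2 (W t) unit_polydisc2)) \<and>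
        (\<forall>t s. 0 \<le> t \<and> t < s \<longrightarrow> compact (closure (W t)) \<and> closure (W t) \<subseteq> W s) \<and>
        (\<forall>t>0. W t = (\<Union>t'\<in>{0..<t}. W t')) \<and>
        (\<forall>t'\<ge>0. closure (W t') = (\<Inter>t\<in>{t'<..}. W t)))"

definition henonF :: "nat \<Rightarrow> complex poly \<Rightarrow> complex \<Rightarrow> c2 \<Rightarrow> c2" where
  "henonF d q \<delta> p = (fst p ^ d + poly q (fst p) + \<delta> * snd p, \<delta> * fst p)"

fun orbit :: "(nat \<Rightarrow> c2 \<Rightarrow> c2) \<Rightarrow> nat \<Rightarrow> c2 \<Rightarrow> c2" where
  "orbit F 0 = id"
| "orbit F (Suc n) = F (Suc n) \<circ> orbit F n"

definition basin :: "(nat \<Rightarrow> c2 \<Rightarrow> c2) \<Rightarrow> c2 set" where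
  "basin F = {p. (\<lambda>n. orbit F n p) \<longlonglongrightarrow> 0}"

end

theory Submission
  imports Defs "HOL-Complex_Analysis.Complex_Analysis"
begin

text \<open>Write \<open>E n\<close> for the composition of the first \<open>n\<close> maps and \<open>\<eta> n = a\<^sub>1 ^ (d ^ n)\<close>, so that
  \<open>\<eta> (n + 1) = \<eta> n ^ d\<close>. The function \<open>M n = max |E n| (\<eta> n)\<close> satisfies \<open>M (n + 1) \<le> C * M n ^ d\<close> on
  the whole plane. Hence a small polydisc or ball of radius \<open>\<rho>\<close> is eventually mapped into itself, the
  basin is the increasing union of its preimages, and \<open>d ^ (- n) * (ln (M n) + ln C)\<close> decreases to
  a bounded above plurisubharmonic function. It is not constant, because some orbit stays above
  \<open>\<eta> n ^ (1/2)\<close> whereas the preimage of the origin under a late \<open>E n\<close> has value close to \<open>ln a\<^sub>1\<close>.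
  The Kobayashi metric vanishes since the derivatives of \<open>E n\<close> tend to \<open>0\<close> along orbits in the basin.
  For the Loewner family, the image of the polydisc of radius \<open>\<rho>\<close> under one map is a thin tube around
  a graph; it is joined to the polydisc by an explicit increasing family of tubes, each the image of
  a polydisc under an automorphism of the plane.\<close>

section \<open>Sub-mean value inequality for logarithms of moduli\<close>

text \<open>Orthogonality of the powers of \<open>cis \<theta>\<close>. The extra factor
  \<open>cis \<theta> ^ m\<close> makes the induction on \<open>p\<close> work: splitting off a
  coefficient raises \<open>m\<close> by one.\<close>

lemma has_integral_cis_poly:
  "((\<lambda>\<theta>. cis \<theta> ^ m * poly p (cis \<theta>)) has_integral
     (if m = 0 then 2 * pi * coeff p 0 else 0)) {0..2*pi}"
proof (induction p arbitrary: m)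
  case 0
  then show ?case by simp
next
  case (pCons a p)
  have cis_int: "((\<lambda>\<theta>. cis \<theta> ^ m) has_integral (if m = 0 then 2 * pi else 0)) {0..2*pi}"
  proof (cases "m = 0")
    case True
    then show ?thesis using has_integral_const_real[of "1::complex" 0 "2*pi"]
      by (simp add: scaleR_conv_of_real)
  next
    case False
    have "((\<lambda>\<theta>. cis (real m * \<theta>)) has_integral
        (cis (real m * (2*pi)) / (\<i> * m) - cis (real m * 0) / (\<i> * m))) {0..2*pi}"
    proof (rule fundamental_theorem_of_calculus)
      fix x :: real
      have "((\<lambda>z. exp (\<i> * of_nat m * z) / (\<i> * m)) has_field_derivative
          exp (\<i> * of_nat m * of_real x)) (at (of_real x))"
        using False by (auto intro!: derivative_eq_intros)
      then show "((\<lambda>\<theta>. cis (real m * \<theta>) / (\<i> * m)) has_vector_derivative cis (real m * x))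
          (at x within {0..2*pi})"
        by (drule_tac has_vector_derivative_real_field) (simp add: cis_conv_exp mult.assoc)
    qed simp
    moreover have "cis (real m * (2*pi)) = 1"
      by (metis cis_multiple_2pi Ints_of_nat mult.commute)
    ultimately show ?thesis using False by (simp add: Complex.DeMoivre)
  qed
  have "((\<lambda>\<theta>. a * cis \<theta> ^ m + cis \<theta> ^ Suc m * poly p (cis \<theta>)) has_integral
      (a * (if m = 0 then 2 * pi else 0) + 0)) {0..2*pi}"
    using pCons.IH[of "Suc m"] has_integral_mult_right[OF cis_int, of a]
    by (intro has_integral_add) auto
  then show ?case
    by (rule has_integral_eq_rhs[OF has_integral_eq[rotated]]) (auto simp: algebra_simps)
qed

lemma mean_Re_poly: "((\<lambda>\<theta>. Re (poly p (cis \<theta>))) has_integral 2 * pi * Re (coeff p 0)) {0..2*pi}"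
  using has_integral_Re[OF has_integral_cis_poly[of 0 p]] by simp

text \<open>On the unit circle \<open>\<zeta> * cnj \<zeta> = 1\<close>, so the product of the two
  non-constant parts loses one factor on each side; a mixed term \<open>a * cnj ?u\<close> has the
  same real part as \<open>cnj a * ?u\<close>. The lemma serves to close real parts of polynomials
  under multiplication.\<close>

lemma Re_poly_mult_cnj_poly:
  "\<exists>s. \<forall>\<zeta>\<in>sphere 0 1. Re (poly p \<zeta> * cnj (poly q \<zeta>)) = Re (poly s \<zeta>)"
proof (induction p arbitrary: q)
  case 0
  show ?case by (rule exI[of _ 0]) simp
next
  case (pCons a p)
  obtain b q' where q: "q = pCons b q'" by (cases q)
  obtain s where s: "\<And>\<zeta>. \<zeta> \<in> sphere 0 1 \<Longrightarrow> Re (poly p \<zeta> * cnj (poly q' \<zeta>)) = Re (poly s \<zeta>)"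
    using pCons.IH by blast
  let ?s = "[:a * cnj b:] + pCons 0 (smult (cnj a) q') + pCons 0 (smult (cnj b) p) + s"
  have "Re (poly (pCons a p) \<zeta> * cnj (poly q \<zeta>)) = Re (poly ?s \<zeta>)" if "\<zeta> \<in> sphere 0 1" for \<zeta>
  proof -
    let ?u = "\<zeta> * poly q' \<zeta>"
    have "\<zeta> * cnj \<zeta> = 1"
      using that by (simp add: complex_norm_square[symmetric])
    then have *: "\<zeta> * poly p \<zeta> * cnj ?u = poly p \<zeta> * cnj (poly q' \<zeta>)"
      by (metis (no_types, lifting) complex_cnj_mult mult.assoc mult.commute mult_1)
    have "poly (pCons a p) \<zeta> * cnj (poly q \<zeta>)
        = a * cnj b + a * cnj ?u + \<zeta> * poly p \<zeta> * cnj b + \<zeta> * poly p \<zeta> * cnj ?u"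
      by (simp add: q algebra_simps)
    also have "Re \<dots> = Re (a * cnj b) + Re (cnj a * ?u) + Re (cnj b * (\<zeta> * poly p \<zeta>))
        + Re (poly s \<zeta>)"
      unfolding * using s[OF that] by (simp add: algebra_simps)
    finally show ?thesis by (simp add: algebra_simps)
  qed
  then show ?case by blast
qed

text \<open>Stone-Weierstrass: on the circle the real parts of polynomials form a real algebra that
  contains the constants and separates points.\<close>

lemma Re_poly_dense_circle:
  assumes "continuous_on (sphere 0 1) v" "e > 0"
  obtains p where "\<And>\<zeta>. \<zeta> \<in> sphere 0 1 \<Longrightarrow> \<bar>v \<zeta> - Re (poly p \<zeta>)\<bar> < e"
proof -
  let ?R = "{h. \<exists>p. \<forall>\<zeta>\<in>sphere 0 1. h \<zeta> = Re (poly p \<zeta>)}"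
  interpret function_ring_on ?R "sphere 0 (1::real) :: complex set"
  proof
    show "compact (sphere 0 1 :: complex set)" by simp
  next
    fix f assume "f \<in> ?R"
    then obtain p where "\<And>\<zeta>. \<zeta> \<in> sphere 0 1 \<Longrightarrow> f \<zeta> = Re (poly p \<zeta>)" by blast
    moreover have "continuous_on (sphere 0 1) (\<lambda>\<zeta>. Re (poly p \<zeta>))"
      by (intro continuous_intros)
    ultimately show "continuous_on (sphere 0 1) f" by (metis (no_types, lifting) continuous_on_cong)
  next
    fix f g assume "f \<in> ?R" "g \<in> ?R"
    then obtain p q where fg: "\<And>\<zeta>. \<zeta> \<in> sphere 0 1 \<Longrightarrow> f \<zeta> = Re (poly p \<zeta>)"
        "\<And>\<zeta>. \<zeta> \<in> sphere 0 1 \<Longrightarrow> g \<zeta> = Re (poly q \<zeta>)" by blast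
    show "(\<lambda>x. f x + g x) \<in> ?R"
      using fg by (auto intro!: exI[of _ "p + q"])
    obtain s where s: "\<And>\<zeta>. \<zeta> \<in> sphere 0 1 \<Longrightarrow>
        Re (poly p \<zeta> * cnj (poly q \<zeta>)) = Re (poly s \<zeta>)"
      using Re_poly_mult_cnj_poly by blast
    \<comment> \<open>A product of real parts splits into an analytic term and a mixed one;
      \<open>s\<close> turns the mixed one into the real part of a polynomial.\<close>
    have "Re A * Re B = Re (A * B / 2) + Re (A * cnj B) / 2" for A B
      by (simp add: field_simps)
    then have "f \<zeta> * g \<zeta> = Re (poly (smult (1/2) (p * q) + smult (1/2) s) \<zeta>)"
      if "\<zeta> \<in> sphere 0 1" for \<zeta>
      using fg[OF that] s[OF that] by (simp add: field_simps)
    then show "(\<lambda>x. f x * g x) \<in> ?R" by blast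
  next
    show "(\<lambda>_. c) \<in> ?R" for c
      by (auto intro!: exI[of _ "[:of_real c:]"])
  next
    fix x y :: complex assume "x \<noteq> y"
    then have "Re x \<noteq> Re y \<or> Im x \<noteq> Im y" by (simp add: complex_eq_iff)
    moreover have "Re \<in> ?R" "Im \<in> ?R"
      by (auto intro: exI[of _ "[:0, 1:]"] exI[of _ "[:0, -\<i>:]"])
    ultimately show "\<exists>f\<in>?R. f x \<noteq> f y" by blast
  qed
  obtain g where "g \<in> ?R" "\<forall>x\<in>sphere 0 1. \<bar>v x - g x\<bar> < e"
    using Stone_Weierstrass_basic[OF assms] by blast
  then show ?thesis using that by fastforce
qed

text \<open>Instead of Jensen's formula: if \<open>P\<close> is a polynomial with \<open>v \<le> Re P \<le> v + 2 e\<close> on the circle,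
  the maximum principle applies to \<open>f exp (-P)\<close>, and \<open>Re (P 0)\<close> is the mean of \<open>Re P\<close>.\<close>
lemma log_submean:
  assumes f: "f holomorphic_on UNIV" and v: "continuous_on (sphere 0 1) v"
    and le: "\<And>\<zeta>. \<zeta> \<in> sphere 0 1 \<Longrightarrow> norm (f \<zeta>) \<le> exp (v \<zeta>)"
  shows "norm (f 0) \<le> exp (1 / (2 * pi) * integral {0..2*pi} (\<lambda>\<theta>. v (cis \<theta>)))"
proof -
  define I where "I = 1 / (2 * pi) * integral {0..2*pi} (\<lambda>\<theta>. v (cis \<theta>))"
  have int: "(\<lambda>\<theta>. v (cis \<theta>)) integrable_on {0..2*pi}"
    by (intro integrable_continuous_real continuous_on_compose2[OF v] continuous_intros) auto
  have bound: "norm (f 0) \<le> exp (I + 2 * e)" if e: "e > 0" for e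
  proof -
    obtain p where p: "\<And>\<zeta>. \<zeta> \<in> sphere 0 1 \<Longrightarrow> \<bar>v \<zeta> - Re (poly p \<zeta>)\<bar> < e"
      using Re_poly_dense_circle[OF v e] by blast
    let ?P = "\<lambda>\<zeta>. poly p \<zeta> + of_real e"
    let ?g = "\<lambda>\<zeta>. f \<zeta> * exp (- ?P \<zeta>)"
    have hol: "?g holomorphic_on UNIV"
      using f by (intro holomorphic_intros) auto
    have "norm (?g 0) \<le> 1"
    proof (rule maximum_modulus_frontier[of ?g "cball 0 1"])
      show "?g holomorphic_on interior (cball 0 1)" "continuous_on (closure (cball 0 1)) ?g"
        using hol holomorphic_on_subset holomorphic_on_imp_continuous_on by blast+
      fix \<zeta> :: complex assume "\<zeta> \<in> frontier (cball 0 1)"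
      then have \<zeta>: "\<zeta> \<in> sphere 0 1" by auto
      have "norm (?g \<zeta>) \<le> exp (v \<zeta>) * exp (- Re (?P \<zeta>))"
        using le[OF \<zeta>] by (simp add: norm_mult)
      also have "\<dots> \<le> 1"
        using p[OF \<zeta>] by (simp flip: exp_add)
      finally show "norm (?g \<zeta>) \<le> 1" .
    qed auto
    then have "norm (f 0) \<le> exp (Re (coeff p 0) + e)"
      by (simp add: norm_mult norm_divide poly_0_coeff_0 exp_add exp_minus exp_diff field_simps)
    also have "Re (coeff p 0) \<le> I + e"
    proof -
      have "2 * pi * Re (coeff p 0) \<le> integral {0..2*pi} (\<lambda>\<theta>. v (cis \<theta>)) + e * (2 * pi)"
      proof (rule has_integral_le[OF mean_Re_poly])
        show "((\<lambda>\<theta>. v (cis \<theta>) + e) has_integral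
            integral {0..2*pi} (\<lambda>\<theta>. v (cis \<theta>)) + e * (2 * pi)) {0..2*pi}"
          using has_integral_const_real[of e 0 "2*pi"] integrable_integral[OF int]
          by (intro has_integral_add) (auto simp: mult.commute)
        show "Re (poly p (cis \<theta>)) \<le> v (cis \<theta>) + e" for \<theta>
          using p[of "cis \<theta>"] by simp
      qed
      then show ?thesis unfolding I_def by (simp add: field_simps)
    qed
    finally show ?thesis by (simp add: add.commute)
  qed
  have "((\<lambda>e. exp (I + 2 * e)) \<longlongrightarrow> exp (I + 2 * 0)) (at_right 0)"
    by (intro tendsto_intros)
  then have "norm (f 0) \<le> exp (I + 2 * 0)"
    by (rule tendsto_lowerbound) (auto simp: eventually_at_filter bound)
  then show ?thesis by (simp add: I_def)
qed

section \<open>Automorphisms of the plane and polydiscs\<close>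

lemma norm_cmul: "norm (cmul c p) = norm c * norm p"
  unfolding cmul_def norm_Pair
  by (cases p) (simp add: norm_mult norm_Pair power_mult_distrib real_sqrt_mult flip: distrib_left)

lemma cmul_cmul: "cmul c (cmul e p) = cmul (c * e) p"
  by (simp add: cmul_def)

lemma cmul_1 [simp]: "cmul 1 p = p"
  by (simp add: cmul_def)

lemma cmul_0 [simp]: "cmul 0 p = 0" "cmul c 0 = 0"
  by (simp_all add: cmul_def zero_prod_def)

lemma continuous_on_cmul [continuous_intros]:
  assumes "continuous_on S f" "continuous_on S g"
  shows "continuous_on S (\<lambda>x. cmul (f x) (g x))"
  unfolding cmul_def using assms by (intro continuous_intros)

lemma norm_pair_le: "norm p \<le> norm (fst p) + norm (snd p)" for p :: c2
  using norm_Pair_le[of "fst p" "snd p"] by simp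

lemma holo2_on_compose:
  assumes "holo2_on f U" "holo2_on g V" "f ` U \<subseteq> V"
  shows "holo2_on (g \<circ> f) U"
  unfolding holo2_on_def
proof
  fix p assume p: "p \<in> U"
  obtain L where L: "(f has_derivative L) (at p)" "\<And>c v. L (cmul c v) = cmul c (L v)"
    using assms(1) p unfolding holo2_on_def by blast
  obtain K where K: "(g has_derivative K) (at (f p))" "\<And>c v. K (cmul c v) = cmul c (K v)"
    using assms p unfolding holo2_on_def by blast
  show "\<exists>L. (g \<circ> f has_derivative L) (at p) \<and> (\<forall>c v. L (cmul c v) = cmul c (L v))"
    using diff_chain_at[OF L(1) K(1)] L(2) K(2) by (intro exI[of _ "K \<circ> L"]) auto
qed

lemma holo2_on_subset: "holo2_on f V \<Longrightarrow> U \<subseteq> V \<Longrightarrow> holo2_on f U"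
  unfolding holo2_on_def by blast

lemma holo2_on_imp_continuous_on: "holo2_on f U \<Longrightarrow> continuous_on U f"
  unfolding holo2_on_def
  by (meson has_derivative_continuous continuous_at_imp_continuous_on)

text \<open>Henon maps, their inverses, scalings and the tube maps below all have components of this
  form, so their holomorphy reduces to one complex variable.\<close>

lemma holo2_on_separated:
  assumes "g1 holomorphic_on UNIV" "h1 holomorphic_on UNIV"
    "g2 holomorphic_on UNIV" "h2 holomorphic_on UNIV"
  shows "holo2_on (\<lambda>p. (g1 (fst p) + h1 (snd p), g2 (fst p) + h2 (snd p))) U"
  unfolding holo2_on_def
proof
  fix p :: c2
  have D: "(g has_derivative (\<lambda>v. deriv g z * v)) (at z)" if "g holomorphic_on UNIV"
    for g :: "complex \<Rightarrow> complex" and z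
    using holomorphic_derivI[OF that, of z] by (simp add: has_field_derivative_def)
  note D1 = has_derivative_compose[of fst _ p UNIV, OF has_derivative_fst[OF has_derivative_ident] D]
  note D2 = has_derivative_compose[of snd _ p UNIV, OF has_derivative_snd[OF has_derivative_ident] D]
  show "\<exists>L. ((\<lambda>p. (g1 (fst p) + h1 (snd p), g2 (fst p) + h2 (snd p))) has_derivative L) (at p) \<and>
      (\<forall>c v. L (cmul c v) = cmul c (L v))"
    by (intro exI conjI, rule has_derivative_Pair[OF
          has_derivative_add[OF D1[OF assms(1)] D2[OF assms(2)]]
          has_derivative_add[OF D1[OF assms(3)] D2[OF assms(4)]]])
       (auto simp: cmul_def algebra_simps)
qed

text \<open>The inverse is an explicit argument, so that a preimage under \<open>f\<close> is also
  an image under \<open>g\<close>: openness and closedness come from the first description,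
  connectedness and compactness from the second.\<close>

definition aut2 :: "(c2 \<Rightarrow> c2) \<Rightarrow> (c2 \<Rightarrow> c2) \<Rightarrow> bool" where
  "aut2 f g \<longleftrightarrow> holo2_on f UNIV \<and> holo2_on g UNIV \<and> (\<forall>x. g (f x) = x) \<and> (\<forall>x. f (g x) = x)"

lemma aut2_id: "aut2 id id"
proof -
  have "id holomorphic_on UNIV" "(\<lambda>z. 0) holomorphic_on (UNIV::complex set)"
    by (auto simp: id_def)
  from holo2_on_separated[OF this this(2) this(1)] show ?thesis
    by (simp add: aut2_def id_def)
qed

lemma aut2_compose: "aut2 f f' \<Longrightarrow> aut2 g g' \<Longrightarrow> aut2 (g \<circ> f) (f' \<circ> g')"
  unfolding aut2_def by (metis comp_apply holo2_on_compose subset_UNIV)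

lemma aut2_sym: "aut2 f g \<Longrightarrow> aut2 g f"
  unfolding aut2_def by blast

lemma aut2_continuous: "aut2 f g \<Longrightarrow> continuous_on S f"
  unfolding aut2_def using holo2_on_imp_continuous_on continuous_on_subset by blast

lemma aut2_vimage_eq: "aut2 f g \<Longrightarrow> f -` S = g ` S"
  unfolding aut2_def
  by (intro equalityI subsetI) (metis image_eqI vimageD, metis imageE vimageI)

lemma biholomorphic2_aut2_vimage:
  assumes "aut2 f g" shows "biholomorphic2 (f -` S) S"
proof -
  have "f ` (f -` S) = S" "g ` S = f -` S"
    using assms aut2_vimage_eq[OF assms] unfolding aut2_def by (auto intro!: image_eqI)
  then show ?thesis
    using assms unfolding biholomorphic2_def aut2_def
    by (intro exI[of _ f] exI[of _ g]) (auto intro: holo2_on_subset)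
qed

lemma domain2_aut2_vimage:
  assumes "aut2 f g" "domain2 S" shows "domain2 (f -` S)"
  using assms aut2_continuous[OF assms(1), of UNIV]
    connected_continuous_image[OF aut2_continuous[OF aut2_sym[OF assms(1)]], of S]
  unfolding domain2_def by (auto simp: open_vimage aut2_vimage_eq[OF assms(1)])
    (metis aut2_vimage_eq open_vimage)

lemma closure_aut2_vimage:
  assumes "aut2 f g" "compact (closure S)"
  shows "closure (f -` S) = f -` closure S"
proof
  have "closed (f -` closure S)"
    using aut2_continuous[OF assms(1), of UNIV] by (intro closed_vimage) auto
  then show "closure (f -` S) \<subseteq> f -` closure S"
    by (intro closure_minimal vimage_mono closure_subset)
  show "f -` closure S \<subseteq> closure (f -` S)"
    unfolding aut2_vimage_eq[OF assms(1)]
    by (intro image_closure_subset aut2_continuous[OF aut2_sym[OF assms(1)]] closure_subset) auto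
qed

lemma compact_aut2_vimage: "aut2 f g \<Longrightarrow> compact S \<Longrightarrow> compact (f -` S)"
  by (metis aut2_vimage_eq aut2_sym aut2_continuous compact_continuous_image)

text \<open>Complex linearity of \<open>L\<close> turns the real derivative along a complex line
  into a complex one. This provides the entire functions for the sub-mean value inequality and the
  derivatives of the discs in the Kobayashi metric.\<close>

lemma holo2_has_field_derivative_line:
  assumes "(f has_derivative L) (at (x + cmul \<zeta> b))" "\<And>c v. L (cmul c v) = cmul c (L v)"
  shows "((\<lambda>\<zeta>. fst (f (x + cmul \<zeta> b))) has_field_derivative fst (L b)) (at \<zeta>)"
    and "((\<lambda>\<zeta>. snd (f (x + cmul \<zeta> b))) has_field_derivative snd (L b)) (at \<zeta>)"
proof -
  have "((\<lambda>\<zeta>. x + cmul \<zeta> b) has_derivative (\<lambda>c. cmul c b)) (at \<zeta>)"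
    unfolding cmul_def by (auto intro!: derivative_eq_intros)
  from has_derivative_compose[OF this assms(1)]
  have D: "((\<lambda>\<zeta>. f (x + cmul \<zeta> b)) has_derivative (\<lambda>c. cmul c (L b))) (at \<zeta>)"
    by (simp add: assms(2))
  show "((\<lambda>\<zeta>. fst (f (x + cmul \<zeta> b))) has_field_derivative fst (L b)) (at \<zeta>)"
    "((\<lambda>\<zeta>. snd (f (x + cmul \<zeta> b))) has_field_derivative snd (L b)) (at \<zeta>)"
    using has_derivative_fst[OF D] has_derivative_snd[OF D]
    by (simp_all add: has_field_derivative_def cmul_def mult.commute[of _ "fst (L b)"]
        mult.commute[of _ "snd (L b)"])
qed

lemma holo2_on_line_holomorphic:
  assumes "holo2_on f UNIV"
  shows "(\<lambda>\<zeta>. fst (f (x + cmul \<zeta> b))) holomorphic_on S"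
    and "(\<lambda>\<zeta>. snd (f (x + cmul \<zeta> b))) holomorphic_on S"
  using assms holo2_has_field_derivative_line unfolding holo2_on_def holomorphic_on_def
  by (meson UNIV_I field_differentiable_at_within field_differentiable_def)+

lemma norm_poly_le:
  fixes p :: "complex poly"
  assumes "\<And>i. norm (coeff p i) \<le> c" "degree p < k" "norm z \<le> 1"
  shows "norm (poly p z) \<le> k * c"
proof -
  have c: "c \<ge> 0" using assms(1) norm_ge_zero order_trans by blast
  have "norm (poly p z) \<le> (\<Sum>i\<le>degree p. norm (coeff p i * z ^ i))"
    unfolding poly_altdef by (rule norm_sum)
  also have "\<dots> \<le> (\<Sum>i\<le>degree p. c)"
    using assms(1,3) c by (intro sum_mono) (auto simp: norm_mult norm_power intro!: mult_mono[of _ c _ 1, simplified] power_le_one)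
  also have "\<dots> \<le> k * c"
    using assms(2) c by (auto intro!: mult_right_mono)
  finally show ?thesis .
qed

lemma norm_poly_le_power:
  fixes p :: "complex poly"
  assumes "\<And>i. norm (coeff p i) \<le> c" "degree p < k" "norm z \<le> t" "1 \<le> t"
  shows "norm (poly p z) \<le> k * c * t ^ (k - 1)"
proof -
  have c: "c \<ge> 0" using assms(1) norm_ge_zero order_trans by blast
  have "norm (poly p z) \<le> (\<Sum>i\<le>degree p. norm (coeff p i * z ^ i))"
    unfolding poly_altdef by (rule norm_sum)
  also have "\<dots> \<le> (\<Sum>i\<le>degree p. c * t ^ (k - 1))"
  proof (rule sum_mono)
    fix i assume "i \<in> {..degree p}"
    then have "t ^ i \<le> t ^ (k - 1)"
      using assms(2,4) by (intro power_increasing) auto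
    moreover have "norm z ^ i \<le> t ^ i"
      using assms(3) by (intro power_mono) auto
    ultimately show "norm (coeff p i * z ^ i) \<le> c * t ^ (k - 1)"
      unfolding norm_mult norm_power using assms(1) c by (intro mult_mono) auto
  qed
  also have "\<dots> \<le> k * (c * t ^ (k - 1))"
    using assms(2,4) c by (auto intro!: mult_right_mono)
  finally show ?thesis by (simp add: mult.assoc)
qed

text \<open>The norm on pairs is Euclidean; polydiscs are the balls of this one.\<close>

definition maxnorm :: "c2 \<Rightarrow> real" where
  "maxnorm p = max (norm (fst p)) (norm (snd p))"

lemma continuous_on_maxnorm [continuous_intros]:
  "continuous_on S f \<Longrightarrow> continuous_on S (\<lambda>x. maxnorm (f x))"
  unfolding maxnorm_def by (intro continuous_intros)

lemma maxnorm_le_norm: "maxnorm p \<le> norm p"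
  unfolding maxnorm_def using norm_fst_le[of "fst p" "snd p"] norm_snd_le[of "snd p" "fst p"] by simp

lemma norm_le_maxnorm: "norm p \<le> 2 * maxnorm p"
  using norm_pair_le[of p] unfolding maxnorm_def by linarith

lemma unit_polydisc2_eq: "unit_polydisc2 = {p. maxnorm p < 1}"
  by (auto simp: unit_polydisc2_def maxnorm_def)

lemma unit_polydisc2_Times: "unit_polydisc2 = ball 0 1 \<times> ball 0 1"
  by (auto simp: unit_polydisc2_def)

lemma domain2_unit_polydisc2: "domain2 unit_polydisc2"
  unfolding domain2_def unit_polydisc2_Times
  by (auto intro: open_Times connected_Times)

lemma closure_unit_polydisc2: "closure unit_polydisc2 = {p. maxnorm p \<le> 1}"
  unfolding unit_polydisc2_Times closure_Times by (auto simp: maxnorm_def)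

lemma compact_closure_unit_polydisc2: "compact (closure unit_polydisc2)"
  unfolding unit_polydisc2_Times closure_Times by (auto intro: compact_Times)

text \<open>The conditions \<open>left\<close> and \<open>right\<close> hold for one-sidedly continuous \<open>t \<mapsto> maxnorm (\<Psi> t p)\<close>.\<close>
lemma loewner_family:
  fixes \<Psi> :: "real \<Rightarrow> c2 \<Rightarrow> c2"
  assumes aut: "\<And>t. t \<ge> 0 \<Longrightarrow> aut2 (\<Psi> t) (\<Phi> t)"
    and less: "\<And>t s p. 0 \<le> t \<Longrightarrow> t < s \<Longrightarrow> maxnorm (\<Psi> t p) \<le> 1 \<Longrightarrow> maxnorm (\<Psi> s p) < 1"
    and left: "\<And>t p. 0 < t \<Longrightarrow> maxnorm (\<Psi> t p) < 1 \<Longrightarrow> \<exists>t'\<in>{0..<t}. maxnorm (\<Psi> t' p) < 1"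
    and right: "\<And>t p. 0 \<le> t \<Longrightarrow> (\<And>s. t < s \<Longrightarrow> maxnorm (\<Psi> s p) < 1) \<Longrightarrow> maxnorm (\<Psi> t p) \<le> 1"
  defines "W \<equiv> \<lambda>t. \<Psi> t -` unit_polydisc2"
  shows "\<forall>t\<ge>0. domain2 (W t)" "\<forall>t\<ge>0. biholomorphic2 (W t) unit_polydisc2"
    "\<forall>t s. 0 \<le> t \<and> t < s \<longrightarrow> compact (closure (W t)) \<and> closure (W t) \<subseteq> W s"
    "\<forall>t>0. W t = (\<Union>t'\<in>{0..<t}. W t')"
    "\<forall>t'\<ge>0. closure (W t') = (\<Inter>t\<in>{t'<..}. W t)"
proof -
  have W: "W t = {p. maxnorm (\<Psi> t p) < 1}" for t
    by (auto simp: W_def unit_polydisc2_eq)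
  have cl: "closure (W t) = \<Psi> t -` closure unit_polydisc2" if "t \<ge> 0" for t
    unfolding W_def by (intro closure_aut2_vimage[OF aut[OF that]] compact_closure_unit_polydisc2)
  then have cl': "closure (W t) = {p. maxnorm (\<Psi> t p) \<le> 1}" if "t \<ge> 0" for t
    using that by (auto simp: closure_unit_polydisc2)
  show "\<forall>t\<ge>0. domain2 (W t)"
    unfolding W_def using domain2_aut2_vimage[OF aut domain2_unit_polydisc2] by blast
  show "\<forall>t\<ge>0. biholomorphic2 (W t) unit_polydisc2"
    unfolding W_def using biholomorphic2_aut2_vimage[OF aut] by blast
  show "\<forall>t s. 0 \<le> t \<and> t < s \<longrightarrow> compact (closure (W t)) \<and> closure (W t) \<subseteq> W s"
    using compact_aut2_vimage[OF aut compact_closure_unit_polydisc2] less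
    by (auto simp: cl) (auto simp: W closure_unit_polydisc2)
  show "\<forall>t>0. W t = (\<Union>t'\<in>{0..<t}. W t')"
    using left less unfolding W by (fastforce intro: less_imp_le)
  show "\<forall>t'\<ge>0. closure (W t') = (\<Inter>t\<in>{t'<..}. W t)"
    using less right by (auto simp: cl') (auto simp: W)
qed

section \<open>Dynamics near the origin\<close>

text \<open>\<open>a\<close> stands for the first term of the given sequence. As the sequence
  decreases, the bounds on the coefficients persist when every term is replaced by the
  first.\<close>

locale henon_sequence =
  fixes d :: nat and a :: real and q :: "nat \<Rightarrow> complex poly" and \<delta> :: "nat \<Rightarrow> complex"
  assumes d_ge_2: "2 \<le> d" and a_pos: "0 < a" and a_less_1: "a < 1"
    and \<delta>_nonzero: "\<And>n. n \<ge> 1 \<Longrightarrow> \<delta> n \<noteq> 0"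
    and degree_less: "\<And>n. n \<ge> 1 \<Longrightarrow> degree (q n) < d"
    and coeff_le: "\<And>n i. n \<ge> 1 \<Longrightarrow> norm (coeff (q n) i) \<le> a ^ (d ^ n)"
    and \<delta>_le: "\<And>n. n \<ge> 1 \<Longrightarrow> norm (\<delta> n) \<le> a ^ (d ^ n)"
begin

definition \<eta> :: "nat \<Rightarrow> real" where "\<eta> n = a ^ (d ^ n)"

definition H :: "nat \<Rightarrow> c2 \<Rightarrow> c2" where "H n = henonF d (q n) (\<delta> n)"

definition H_inv :: "nat \<Rightarrow> c2 \<Rightarrow> c2" where
  "H_inv n p = (snd p / \<delta> n, (fst p - (snd p / \<delta> n) ^ d - poly (q n) (snd p / \<delta> n)) / \<delta> n)"

definition E :: "nat \<Rightarrow> c2 \<Rightarrow> c2" where "E = orbit H"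

primrec E_inv :: "nat \<Rightarrow> c2 \<Rightarrow> c2" where
  "E_inv 0 = id"
| "E_inv (Suc n) = E_inv n \<circ> H_inv (Suc n)"

text \<open>The share \<open>d\<close> comes from the at most \<open>d\<close> coefficients of
  \<open>q n\<close>, and one unit each from the leading power and from the term with
  \<open>\<delta> n\<close>.\<close>

definition C :: real where "C = real d + 2"

text \<open>Chosen so that \<open>C * \<rho> = 1/8\<close>: one map then shrinks \<open>M\<close> by
  a factor 8, which leaves room for the factor 2 between the two norms.\<close>

definition \<rho> :: real where "\<rho> = 1 / (8 * C)"

definition M :: "nat \<Rightarrow> c2 \<Rightarrow> real" where "M n p = max (maxnorm (E n p)) (\<eta> n)"

lemma C_ge_4: "4 \<le> C" using d_ge_2 by (simp add: C_def)

lemma \<rho>_bounds: "0 < \<rho>" "\<rho> \<le> 1/32"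
  using C_ge_4 by (auto simp: \<rho>_def field_simps)

lemma C_\<rho>: "C * \<rho> = 1/8" using C_ge_4 by (simp add: \<rho>_def)

lemma \<eta>_pos: "0 < \<eta> n" and \<eta>_less_1: "\<eta> n < 1"
  using a_pos a_less_1 d_ge_2 by (auto simp: \<eta>_def intro!: power_Suc_less_one power_less_one_iff[THEN iffD2])

lemma \<eta>_Suc: "\<eta> (Suc n) = \<eta> n ^ d"
  by (simp add: \<eta>_def power_mult[symmetric] mult.commute)

lemma \<eta>_tendsto_0: "\<eta> \<longlonglongrightarrow> 0"
proof (rule tendsto_sandwich[of "\<lambda>_. 0" _ _ "\<lambda>n. a ^ n"])
  have "n \<le> d ^ n" for n
    using d_ge_2 by (meson less_exp less_imp_le order_trans power_mono zero_le)
  then show "\<forall>\<^sub>F n in sequentially. \<eta> n \<le> a ^ n"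
    unfolding \<eta>_def using a_pos a_less_1 by (auto intro!: always_eventually power_decreasing)
  show "(\<lambda>n. a ^ n) \<longlonglongrightarrow> 0"
    using a_pos a_less_1 by (intro LIMSEQ_power_zero) auto
qed (auto intro!: always_eventually less_imp_le \<eta>_pos)

text \<open>From this index on the perturbations are of second order in \<open>\<rho>\<close>. The
  square is what makes the tubes of the Loewner family nearly straight.\<close>

definition N :: nat where "N = (SOME N. \<forall>n\<ge>N. \<eta> n \<le> \<rho>\<^sup>2)"

lemma \<eta>_le_\<rho>2: "N \<le> n \<Longrightarrow> \<eta> n \<le> \<rho>\<^sup>2"
proof -
  have "\<forall>\<^sub>F n in sequentially. \<eta> n < \<rho>\<^sup>2"
    using \<rho>_bounds by (intro order_tendstoD[OF \<eta>_tendsto_0]) auto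
  then have "\<exists>N. \<forall>n\<ge>N. \<eta> n \<le> \<rho>\<^sup>2"
    unfolding eventually_sequentially using less_imp_le by blast
  from someI_ex[OF this] show "N \<le> n \<Longrightarrow> \<eta> n \<le> \<rho>\<^sup>2"
    by (simp add: N_def)
qed

lemma \<eta>_le_\<rho>: "N \<le> n \<Longrightarrow> \<eta> n \<le> \<rho>"
  using \<eta>_le_\<rho>2[of n] \<rho>_bounds mult_left_le[of \<rho> \<rho>] unfolding power2_eq_square by linarith

lemma \<delta>_le_\<eta>: "n \<ge> 1 \<Longrightarrow> norm (\<delta> n) \<le> \<eta> n"
  using \<delta>_le by (simp add: \<eta>_def)

lemma norm_q_le: "n \<ge> 1 \<Longrightarrow> norm z \<le> 1 \<Longrightarrow> norm (poly (q n) z) \<le> d * \<eta> n"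
  using norm_poly_le[OF coeff_le degree_less] by (simp add: \<eta>_def)

text \<open>The perturbation has size \<open>\<eta> (Suc n) = \<eta> n ^ d\<close>, which is at most
  \<open>m n x ^ d\<close> because of the floor \<open>\<eta> n\<close> in \<open>m\<close>; so
  every term is bounded by a multiple of the same power. Far from the origin
  \<open>\<eta> < 1\<close> and \<open>degree (q n) < d\<close> give the same bound, so that it
  holds on the whole plane.\<close>

lemma H_step:
  defines "m \<equiv> \<lambda>n x. max (maxnorm x) (\<eta> n)"
  shows "m (Suc n) (H (Suc n) x) \<le> C * m n x ^ d"
proof -
  let ?m = "m n x"
  have z: "norm (fst x) \<le> ?m" and w: "norm (snd x) \<le> ?m" and \<eta>m: "\<eta> n \<le> ?m" and pos: "0 < ?m"
    using \<eta>_pos[of n] by (auto simp: m_def maxnorm_def)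
  have \<eta>': "\<eta> (Suc n) \<le> ?m ^ d"
    unfolding \<eta>_Suc using \<eta>m \<eta>_pos[of n] by (intro power_mono) auto
  have pow: "?m ^ (d - 1) \<le> ?m ^ d" "?m \<le> ?m ^ d" if "1 \<le> ?m"
    using that d_ge_2 power_increasing[of 1 d ?m] by (auto intro: power_increasing)
  have q: "norm (poly (q (Suc n)) (fst x)) \<le> d * ?m ^ d"
  proof (cases "?m \<le> 1")
    case True
    then have "norm (poly (q (Suc n)) (fst x)) \<le> d * \<eta> (Suc n)"
      using norm_q_le[of "Suc n" "fst x"] z by simp
    also have "\<dots> \<le> d * ?m ^ d" using \<eta>' by (intro mult_left_mono) auto
    finally show ?thesis .
  next
    case False
    then have "norm (poly (q (Suc n)) (fst x)) \<le> d * \<eta> (Suc n) * ?m ^ (d - 1)"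
      using norm_poly_le_power[OF coeff_le degree_less, of "Suc n" "fst x" ?m] z
      by (simp add: \<eta>_def)
    also have "\<dots> \<le> d * ?m ^ d"
    proof (rule mult_mono)
      show "d * \<eta> (Suc n) \<le> d"
        using \<eta>_less_1[of "Suc n"] by (simp add: mult_left_le)
    qed (use False pow pos in auto)
    finally show ?thesis .
  qed
  have \<delta>: "norm (\<delta> (Suc n) * y) \<le> ?m ^ d" if "norm y \<le> ?m" for y
  proof -
    have *: "norm (\<delta> (Suc n) * y) \<le> \<eta> (Suc n) * ?m"
      unfolding norm_mult using that \<delta>_le_\<eta>[of "Suc n"] \<eta>_pos[of "Suc n"]
      by (intro mult_mono) auto
    show ?thesis
    proof (cases "?m \<le> 1")
      case True
      then have "\<eta> (Suc n) * ?m \<le> \<eta> (Suc n)" using \<eta>_pos[of "Suc n"] by (simp add: mult_left_le)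
      then show ?thesis using * \<eta>' by linarith
    next
      case False
      then have "\<eta> (Suc n) * ?m \<le> ?m" using \<eta>_less_1[of "Suc n"] pos by simp
      then show ?thesis using * pow False by linarith
    qed
  qed
  have "norm (fst (H (Suc n) x)) \<le> norm (fst x ^ d) + norm (poly (q (Suc n)) (fst x))
      + norm (\<delta> (Suc n) * snd x)"
    unfolding H_def henonF_def by (simp add: norm_triangle_ineq order_trans[OF norm_triangle_ineq])
  also have "norm (fst x ^ d) \<le> ?m ^ d"
    using z by (simp add: norm_power power_mono)
  finally have f: "norm (fst (H (Suc n) x)) \<le> C * ?m ^ d"
    using q \<delta>[OF w] by (simp add: C_def algebra_simps)
  have "?m ^ d \<le> C * ?m ^ d" using C_ge_4 pos by simp
  then show ?thesis
    using f \<delta>[OF z] \<eta>' by (auto simp: m_def maxnorm_def H_def henonF_def)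
qed

lemma E_Suc: "E (Suc n) p = H (Suc n) (E n p)" by (simp add: E_def)

lemma aut2_H: "n \<ge> 1 \<Longrightarrow> aut2 (H n) (H_inv n)"
proof -
  assume n: "n \<ge> 1"
  have "holo2_on (\<lambda>p. ((fst p ^ d + poly (q n) (fst p)) + \<delta> n * snd p, \<delta> n * fst p + 0 * snd p)) UNIV"
    by (rule holo2_on_separated[of "\<lambda>z. z ^ d + poly (q n) z" "\<lambda>w. \<delta> n * w" "\<lambda>z. \<delta> n * z" "\<lambda>w. 0 * w"])
      (intro holomorphic_intros)+
  moreover have "holo2_on (\<lambda>p. (0 * fst p + snd p / \<delta> n,
      fst p / \<delta> n + (- ((snd p / \<delta> n) ^ d) - poly (q n) (snd p / \<delta> n)) / \<delta> n)) UNIV"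
    by (rule holo2_on_separated[of "\<lambda>z. 0 * z" "\<lambda>w. w / \<delta> n" "\<lambda>z. z / \<delta> n"
        "\<lambda>w. (- ((w / \<delta> n) ^ d) - poly (q n) (w / \<delta> n)) / \<delta> n"])
      (use \<delta>_nonzero[OF n] in \<open>auto intro!: holomorphic_intros\<close>)
  moreover have "(\<lambda>p. ((fst p ^ d + poly (q n) (fst p)) + \<delta> n * snd p, \<delta> n * fst p + 0 * snd p)) = H n"
    by (simp add: fun_eq_iff H_def henonF_def)
  moreover have "(\<lambda>p. (0 * fst p + snd p / \<delta> n,
      fst p / \<delta> n + (- ((snd p / \<delta> n) ^ d) - poly (q n) (snd p / \<delta> n)) / \<delta> n)) = H_inv n"
    by (simp add: fun_eq_iff H_inv_def diff_divide_distrib add_divide_distrib)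
  ultimately show ?thesis
    using \<delta>_nonzero[OF n] by (simp add: aut2_def H_def H_inv_def henonF_def)
qed

lemma aut2_E: "aut2 (E n) (E_inv n)"
proof (induction n)
  case 0
  then show ?case using aut2_id by (simp add: E_def del: id_apply)
next
  case (Suc n)
  have "E (Suc n) = H (Suc n) \<circ> E n" by (simp add: E_def)
  then show ?case using aut2_compose[OF Suc aut2_H[of "Suc n"]] by (simp only: E_inv.simps)
qed

lemma E_E_inv [simp]: "E n (E_inv n p) = p" and E_inv_E [simp]: "E_inv n (E n p) = p"
  using aut2_E[of n] unfolding aut2_def by blast+

lemma M_Suc: "M (Suc n) p \<le> C * M n p ^ d"
  using H_step[of n "E n p"] by (simp add: M_def E_Suc)

lemma M_pos: "0 < M n p" using \<eta>_pos[of n] by (simp add: M_def)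

text \<open>As \<open>d\<close> is at least 2, one factor \<open>M n p\<close> can be traded for
  \<open>\<rho>\<close>, and \<open>C * \<rho> = 1/8\<close>.\<close>

lemma M_Suc_small:
  assumes "M n p \<le> \<rho>"
  shows "M (Suc n) p \<le> M n p / 8"
proof -
  have "M n p ^ d \<le> M n p ^ 2"
    using assms M_pos[of n p] \<rho>_bounds d_ge_2 by (intro power_decreasing) auto
  then have "C * M n p ^ d \<le> C * (M n p * M n p)"
    using C_ge_4 by (simp add: power2_eq_square)
  also have "\<dots> \<le> C * (\<rho> * M n p)"
    using assms C_ge_4 M_pos[of n p] by (intro mult_left_mono mult_right_mono) auto
  also have "\<dots> = M n p / 8"
    using C_\<rho> by (simp flip: mult.assoc)
  finally show ?thesis using M_Suc[of n p] by linarith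
qed

lemma M_decay:
  assumes "M n p \<le> \<rho>"
  shows "M (n + k) p \<le> \<rho> * (1/8) ^ k"
proof (induction k)
  case 0
  then show ?case using assms by simp
next
  case (Suc k)
  have "\<rho> * (1/8) ^ k \<le> \<rho>" using \<rho>_bounds by (simp add: mult_left_le power_le_one)
  then have "M (Suc (n + k)) p \<le> M (n + k) p / 8"
    using Suc by (intro M_Suc_small) linarith
  then show ?case using Suc by simp
qed

lemma M_le_\<rho>_iff: "N \<le> n \<Longrightarrow> M n p \<le> \<rho> \<longleftrightarrow> maxnorm (E n p) \<le> \<rho>"
  using \<eta>_le_\<rho>[of n] by (auto simp: M_def)

text \<open>At index \<open>N\<close> and later the floor in \<open>M\<close> lies below
  \<open>\<rho>\<close>, so \<open>maxnorm\<close> alone decides whether \<open>M_decay\<close>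
  applies. The strict \<open>n < m\<close> guarantees at least one contraction.\<close>

lemma trapped:
  assumes "N \<le> n" "maxnorm (E n p) \<le> \<rho>" "n < m"
  shows "maxnorm (E m p) \<le> \<rho> / 8"
proof -
  obtain k where k: "m = n + Suc k" using assms(3) less_imp_Suc_add by auto
  have "\<rho> * (1/8) ^ Suc k \<le> \<rho> / 8" using \<rho>_bounds by (simp add: mult_left_le power_le_one)
  then have "M m p \<le> \<rho> / 8"
    unfolding k using M_decay[of n p "Suc k"] assms M_le_\<rho>_iff by fastforce
  then show ?thesis by (simp add: M_def)
qed

lemma basinI:
  assumes "N \<le> n" "maxnorm (E n p) \<le> \<rho>"
  shows "p \<in> basin H"
proof -
  have "(\<lambda>k. norm (E (k + n) p)) \<longlonglongrightarrow> 0"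
  proof (rule tendsto_sandwich[of "\<lambda>_. 0" _ _ "\<lambda>k. 2 * (\<rho> * (1/8) ^ k)"])
    have "norm (E (k + n) p) \<le> 2 * (\<rho> * (1/8) ^ k)" for k
      using norm_le_maxnorm[of "E (k + n) p"] M_decay[of n p k] assms M_le_\<rho>_iff[of n p]
      by (simp add: M_def add.commute)
    then show "\<forall>\<^sub>F k in sequentially. norm (E (k + n) p) \<le> 2 * (\<rho> * (1/8) ^ k)" by simp
    have "(\<lambda>k. 2 * (\<rho> * (1/8) ^ k)) \<longlonglongrightarrow> 2 * (\<rho> * 0)"
      by (intro tendsto_intros LIMSEQ_power_zero) auto
    then show "(\<lambda>k. 2 * (\<rho> * (1/8) ^ k)) \<longlonglongrightarrow> 0" by simp
  qed auto
  then have "(\<lambda>k. E (k + n) p) \<longlonglongrightarrow> 0" by (rule tendsto_norm_zero_cancel)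
  then show ?thesis
    unfolding basin_def E_def by (auto dest: LIMSEQ_offset)
qed

lemma basin_tendsto: "p \<in> basin H \<Longrightarrow> (\<lambda>n. norm (E n p)) \<longlonglongrightarrow> 0"
  unfolding basin_def E_def by (auto intro: tendsto_norm_zero)

lemma basin_eventually_less:
  "p \<in> basin H \<Longrightarrow> 0 < e \<Longrightarrow> \<forall>\<^sub>F n in sequentially. norm (E n p) < e"
  using order_tendstoD[OF basin_tendsto] by blast

section \<open>Exhaustion of the basin by preimages of balls\<close>

definition exhaustion_ball :: "nat \<Rightarrow> c2 set" where
  "exhaustion_ball n = {p. norm (E (N + n) p) < \<rho>}"

lemma basin_eq_Union_balls: "basin H = (\<Union>n. exhaustion_ball n)"
proof
  show "(\<Union>n. exhaustion_ball n) \<subseteq> basin H"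
  proof
    fix p assume "p \<in> (\<Union>n. exhaustion_ball n)"
    then obtain n where "norm (E (N + n) p) < \<rho>" by (auto simp: exhaustion_ball_def)
    then have "maxnorm (E (N + n) p) \<le> \<rho>" using maxnorm_le_norm[of "E (N + n) p"] by linarith
    then show "p \<in> basin H" by (rule basinI[OF le_add1])
  qed
  show "basin H \<subseteq> (\<Union>n. exhaustion_ball n)"
  proof
    fix p assume "p \<in> basin H"
    then obtain n0 where "\<And>n. n \<ge> n0 \<Longrightarrow> norm (E n p) < \<rho>"
      using basin_eventually_less \<rho>_bounds(1) unfolding eventually_sequentially by blast
    then show "p \<in> (\<Union>n. exhaustion_ball n)"
      unfolding exhaustion_ball_def using le_add2[of n0 N] by blast
  qed
qed

text \<open>A Euclidean ball lies in the polydisc of the same radius; one map shrinks the polydisc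
  by 8, and returning to the Euclidean norm costs only a factor 2. Indices start at
  \<open>N\<close>, where trapping begins.\<close>

lemma exhaustion_ball_mono: "exhaustion_ball n \<subseteq> exhaustion_ball (Suc n)"
proof
  fix p assume "p \<in> exhaustion_ball n"
  then have "maxnorm (E (N + n) p) \<le> \<rho>"
    using maxnorm_le_norm[of "E (N + n) p"] by (simp add: exhaustion_ball_def)
  then have "maxnorm (E (N + Suc n) p) \<le> \<rho> / 8" by (rule trapped[OF le_add1]) simp
  then show "p \<in> exhaustion_ball (Suc n)"
    using norm_le_maxnorm[of "E (N + Suc n) p"] \<rho>_bounds by (simp add: exhaustion_ball_def)
qed

lemma exhaustion_ball_biholomorphic:
  "domain2 (exhaustion_ball n)" "biholomorphic2 (exhaustion_ball n) unit_ball2"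
proof -
  have "holo2_on (cmul c) UNIV" for c
    using holo2_on_separated[of "\<lambda>z. c * z" "\<lambda>w. 0" "\<lambda>z. 0" "\<lambda>w. c * w"]
    by (simp add: cmul_def[abs_def] holomorphic_intros)
  then have aut: "aut2 (cmul (1 / \<rho>)) (cmul \<rho>)"
    using \<rho>_bounds by (simp add: aut2_def cmul_cmul)
  have eq: "exhaustion_ball n = (cmul (1 / \<rho>) \<circ> E (N + n)) -` unit_ball2"
    using \<rho>_bounds unfolding exhaustion_ball_def unit_ball2_def vimage_def
    by (simp add: norm_cmul norm_divide)
  have dom: "domain2 unit_ball2" by (simp add: domain2_def unit_ball2_def)
  show "domain2 (exhaustion_ball n)" "biholomorphic2 (exhaustion_ball n) unit_ball2"
    unfolding eq by (intro domain2_aut2_vimage[OF aut2_compose[OF aut2_E aut] dom]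
        biholomorphic2_aut2_vimage[OF aut2_compose[OF aut2_E aut]])+
qed

section \<open>Vanishing of the Kobayashi-Royden pseudometric\<close>

definition dH :: "nat \<Rightarrow> c2 \<Rightarrow> c2 \<Rightarrow> c2" where
  "dH n x v = ((of_nat d * fst x ^ (d - 1) + poly (pderiv (q n)) (fst x)) * fst v + \<delta> n * snd v,
     \<delta> n * fst v)"

primrec dE :: "nat \<Rightarrow> c2 \<Rightarrow> c2 \<Rightarrow> c2" where
  "dE 0 p v = v"
| "dE (Suc n) p v = dH (Suc n) (E n p) (dE n p v)"

lemma has_derivative_H: "(H n has_derivative dH n x) (at x)"
proof -
  have "((\<lambda>z. z ^ d + poly (q n) z) has_field_derivative
      of_nat d * fst x ^ (d - 1) + poly (pderiv (q n)) (fst x)) (at (fst x))"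
    using d_ge_2 by (auto intro!: derivative_eq_intros poly_DERIV)
  from has_derivative_compose[of fst fst x UNIV, OF has_derivative_fst[OF has_derivative_ident]
      this[unfolded has_field_derivative_def]]
  have "((\<lambda>p. fst p ^ d + poly (q n) (fst p)) has_derivative
      (\<lambda>v. (of_nat d * fst x ^ (d - 1) + poly (pderiv (q n)) (fst x)) * fst v)) (at x)" .
  then show ?thesis
    unfolding H_def[abs_def] henonF_def[abs_def] dH_def[abs_def]
    by (intro has_derivative_Pair has_derivative_add has_derivative_mult_right
        has_derivative_fst has_derivative_snd has_derivative_ident)
qed

lemma has_derivative_E: "(E n has_derivative dE n p) (at p)"
proof (induction n)
  case 0
  show ?case by (simp add: E_def id_def)
next
  case (Suc n)
  then have "((\<lambda>p. H (Suc n) (E n p)) has_derivative (\<lambda>v. dH (Suc n) (E n p) (dE n p v))) (at p)"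
    by (rule has_derivative_compose[OF _ has_derivative_H])
  then show ?case unfolding E_Suc[abs_def] by simp
qed

text \<open>Since \<open>d\<close> is at least 2, the derivative of the leading power vanishes at
  the origin. The share \<open>d * d\<close> comes from at most \<open>d\<close> coefficients of the
  derivative of \<open>q n\<close>, each at most \<open>d * \<eta> n\<close>, and the 2 from the two
  entries \<open>\<delta> n\<close>.\<close>

lemma norm_dH_le:
  assumes "n \<ge> 1" "norm (fst x) \<le> 1"
  shows "norm (dH n x v) \<le> (d * norm (fst x) + (d * d + 2) * \<eta> n) * norm v"
proof -
  have \<eta>: "0 \<le> \<eta> n" using \<eta>_pos[of n] by simp
  have "norm (coeff (pderiv (q n)) i) \<le> d * \<eta> n" for i
  proof (cases "Suc i \<le> degree (q n)")
    case True
    then have "Suc i \<le> d" using degree_less[OF assms(1)] by linarith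
    have "norm (coeff (pderiv (q n)) i) = Suc i * norm (coeff (q n) (Suc i))"
      by (simp only: coeff_pderiv norm_mult norm_of_nat)
    also have "\<dots> \<le> d * \<eta> n"
      using \<open>Suc i \<le> d\<close> coeff_le[OF assms(1), of "Suc i"]
      unfolding \<eta>_def by (intro mult_mono) (simp_all only: of_nat_le_iff of_nat_0_le_iff norm_ge_zero)
    finally show ?thesis .
  next
    case False
    then show ?thesis using \<eta> by (simp add: coeff_pderiv coeff_eq_0)
  qed
  then have "norm (poly (pderiv (q n)) (fst x)) \<le> d * (d * \<eta> n)"
    using norm_poly_le[of "pderiv (q n)" "d * \<eta> n" d "fst x"] assms degree_less[OF assms(1)]
    by (simp add: degree_pderiv)
  moreover have "norm (fst x ^ (d - 1)) \<le> norm (fst x)"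
    using assms(2) d_ge_2 power_decreasing[of 1 "d - 1" "norm (fst x)"] by (simp add: norm_power)
  ultimately have A: "norm (of_nat d * fst x ^ (d - 1) + poly (pderiv (q n)) (fst x))
      \<le> d * norm (fst x) + d * (d * \<eta> n)"
    by (intro order_trans[OF norm_triangle_ineq] add_mono) (auto simp: norm_mult intro: mult_left_mono)
  have \<delta>: "norm (\<delta> n) \<le> \<eta> n" by (rule \<delta>_le_\<eta>[OF assms(1)])
  have v: "norm (fst v) \<le> norm v" "norm (snd v) \<le> norm v"
    using norm_fst_le[of "fst v" "snd v"] norm_snd_le[of "snd v" "fst v"] by simp_all
  have "norm (fst (dH n x v)) \<le> (d * norm (fst x) + d * (d * \<eta> n)) * norm v + \<eta> n * norm v"
    unfolding dH_def fst_conv using A \<delta> v \<eta>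
    by (intro order_trans[OF norm_triangle_ineq] add_mono) (auto simp: norm_mult intro!: mult_mono)
  moreover have "norm (snd (dH n x v)) \<le> \<eta> n * norm v"
    unfolding dH_def snd_conv using \<delta> v \<eta> by (auto simp: norm_mult intro!: mult_mono)
  ultimately show ?thesis
    using norm_pair_le[of "dH n x v"] by (simp add: algebra_simps)
qed

text \<open>Along an orbit in the basin the factor in \<open>norm_dH_le\<close> tends to 0, so from
  some index on each map at least halves the vector.\<close>

lemma dE_tendsto_0:
  assumes "p \<in> basin H"
  shows "(\<lambda>n. norm (dE n p v)) \<longlonglongrightarrow> 0"
proof -
  have "(\<lambda>n. d * norm (E n p) + (d * d + 2) * \<eta> (Suc n)) \<longlonglongrightarrow> real d * 0 + real (d * d + 2) * 0"
    using basin_tendsto[OF assms] LIMSEQ_Suc[OF \<eta>_tendsto_0] by (intro tendsto_intros)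
  then have "\<forall>\<^sub>F n in sequentially. d * norm (E n p) + (d * d + 2) * \<eta> (Suc n) < 1/2"
    by (intro order_tendstoD) auto
  then obtain k where k: "\<And>n. n \<ge> k \<Longrightarrow>
      d * norm (E n p) + (d * d + 2) * \<eta> (Suc n) < 1/2 \<and> norm (E n p) < 1"
    using basin_eventually_less[OF assms, of 1] eventually_conj
    unfolding eventually_sequentially by (metis (no_types, lifting) nle_le order_trans zero_less_one)
  have *: "norm (dE (k + n) p v) \<le> norm (dE k p v) * (1/2) ^ n" for n
  proof (induction n)
    case (Suc n)
    have E: "norm (fst (E (k + n) p)) \<le> norm (E (k + n) p)"
      using norm_fst_le[of "fst (E (k + n) p)" "snd (E (k + n) p)"] by simp
    have "norm (dE (k + Suc n) p v)
      \<le> (d * norm (fst (E (k + n) p)) + (d * d + 2) * \<eta> (Suc (k + n))) * norm (dE (k + n) p v)"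
      using norm_dH_le[of "Suc (k + n)" "E (k + n) p" "dE (k + n) p v"] E k[of "k + n"] by simp
    also have "\<dots> \<le> (1/2) * norm (dE (k + n) p v)"
      using k[of "k + n"] mult_left_mono[OF E, of "real d"] by (intro mult_right_mono) auto
    finally show ?case using Suc by simp
  qed simp
  have "(\<lambda>n. norm (dE k p v) * (1/2) ^ n) \<longlonglongrightarrow> 0"
    by (intro tendsto_mult_right_zero LIMSEQ_power_zero) simp
  then have "(\<lambda>n. norm (dE (k + n) p v)) \<longlonglongrightarrow> 0"
    by (rule Lim_null_comparison[rotated]) (simp add: *)
  then have "(\<lambda>n. norm (dE (n + k) p v)) \<longlonglongrightarrow> 0" by (simp only: add.commute)
  then show ?thesis by (rule LIMSEQ_offset)
qed

text \<open>The flat disc of radius at most \<open>\<rho> / 2\<close> about \<open>E n p\<close> in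
  the direction \<open>dE n p v\<close> stays in the trapping polydisc; its pullback under
  \<open>E_inv n\<close> is a disc in the basin tangent to \<open>v\<close>.\<close>

lemma exists_large_disc:
  assumes "N \<le> n" "norm (E n p) < \<rho> / 2"
  shows "\<exists>\<phi>. hol_disc \<phi> \<and> \<phi> ` ball 0 1 \<subseteq> basin H \<and> \<phi> 0 = p \<and>
    cmul (of_real (2 * norm (dE n p v) / \<rho>)) (disc_deriv0 \<phi>) = v"
proof -
  obtain L where L: "(E_inv n has_derivative L) (at (E n p))" "\<And>c v. L (cmul c v) = cmul c (L v)"
    using aut2_E[of n] unfolding aut2_def holo2_on_def by blast
  have "((\<lambda>x. x) has_derivative (\<lambda>v. L (dE n p v))) (at p)"
    using has_derivative_compose[OF has_derivative_E L(1)] by simp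
  then have inv: "L (dE n p v) = v"
    using has_derivative_unique[OF _ has_derivative_ident] by metis
  \<comment> \<open>If \<open>dE n p v = 0\<close>, division by zero makes \<open>\<xi>\<close> zero
    and the disc constant; then \<open>v = 0\<close> as well, so the claim survives.\<close>
  define \<xi> where "\<xi> = cmul (of_real (\<rho> / (2 * norm (dE n p v)))) (dE n p v)"
  define \<phi> where "\<phi> = (\<lambda>\<zeta>. E_inv n (E n p + cmul \<zeta> \<xi>))"
  have \<xi>: "norm \<xi> \<le> \<rho> / 2"
    using \<rho>_bounds by (simp add: \<xi>_def norm_cmul norm_mult norm_divide)
  have "hol_disc \<phi>"
    unfolding hol_disc_def \<phi>_def using holo2_on_line_holomorphic aut2_E[of n] unfolding aut2_def by blast
  moreover have "\<phi> ` ball 0 1 \<subseteq> basin H"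
  proof (rule image_subsetI)
    fix \<zeta> :: complex assume "\<zeta> \<in> ball 0 1"
    then have "norm (cmul \<zeta> \<xi>) \<le> \<rho> / 2"
      unfolding norm_cmul using \<xi> mult_mono[of "norm \<zeta>" 1 "norm \<xi>" "\<rho> / 2"] by simp
    then have "norm (E n p + cmul \<zeta> \<xi>) \<le> \<rho>"
      using assms(2) norm_triangle_ineq[of "E n p" "cmul \<zeta> \<xi>"] by linarith
    then have "maxnorm (E n (\<phi> \<zeta>)) \<le> \<rho>"
      unfolding \<phi>_def E_E_inv by (rule order_trans[OF maxnorm_le_norm])
    then show "\<phi> \<zeta> \<in> basin H" by (rule basinI[OF assms(1)])
  qed
  moreover have "\<phi> 0 = p" by (simp add: \<phi>_def)
  moreover have "disc_deriv0 \<phi> = L \<xi>"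
  proof -
    have "(E_inv n has_derivative L) (at (E n p + cmul 0 \<xi>))" using L(1) by simp
    from holo2_has_field_derivative_line[OF this L(2)] show ?thesis
      by (simp add: disc_deriv0_def \<phi>_def DERIV_imp_deriv)
  qed
  moreover have "cmul (of_real (2 * norm (dE n p v) / \<rho>)) (L \<xi>) = v"
  proof (cases "dE n p v = 0")
    case True
    have "L 0 = 0"
      using has_derivative_bounded_linear[OF L(1)] linear_simps(3) by blast
    then have "v = 0" using inv True by simp
    then show ?thesis using True by simp
  next
    case False
    then have "2 * norm (dE n p v) / \<rho> * (\<rho> / (2 * norm (dE n p v))) = 1"
      using \<rho>_bounds by (simp add: field_simps)
    then show ?thesis
      by (simp only: \<xi>_def L(2) cmul_cmul inv of_real_1 cmul_1 flip: of_real_mult)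
  qed
  ultimately show ?thesis by auto
qed

text \<open>The discs of \<open>exists_large_disc\<close> compete in the infimum with values
  \<open>2 * norm (dE n p v) / \<rho>\<close>, which tend to 0.\<close>

lemma kobayashi_royden_basin:
  assumes "p \<in> basin H"
  shows "kobayashi_royden (basin H) p v = 0"
proof -
  define S where "S = {norm \<alpha> | \<alpha> \<phi>. hol_disc \<phi> \<and> \<phi> ` ball 0 1 \<subseteq> basin H \<and>
       \<phi> 0 = p \<and> cmul \<alpha> (disc_deriv0 \<phi>) = v}"
  have bdd: "bdd_below S" by (rule bdd_belowI[of _ 0]) (auto simp: S_def)
  have ev: "\<forall>\<^sub>F n in sequentially. 2 * norm (dE n p v) / \<rho> \<in> S"
  proof (rule eventually_mono[OF eventually_conj[OF basin_eventually_less[OF assms]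
        eventually_ge_at_top[of N]]])
    show "0 < \<rho> / 2" using \<rho>_bounds by simp
    fix n assume "norm (E n p) < \<rho> / 2 \<and> N \<le> n"
    then obtain \<phi> where "hol_disc \<phi> \<and> \<phi> ` ball 0 1 \<subseteq> basin H \<and> \<phi> 0 = p \<and>
        cmul (of_real (2 * norm (dE n p v) / \<rho>)) (disc_deriv0 \<phi>) = v"
      using exists_large_disc by blast
    moreover have "norm (of_real (2 * norm (dE n p v) / \<rho>) :: complex) = 2 * norm (dE n p v) / \<rho>"
      using \<rho>_bounds unfolding norm_of_real by simp
    ultimately show "2 * norm (dE n p v) / \<rho> \<in> S"
      unfolding S_def by (intro CollectI exI[of _ "of_real (2 * norm (dE n p v) / \<rho>)"]) auto
  qed
  have "(\<lambda>n. 2 * norm (dE n p v) / \<rho>) \<longlonglongrightarrow> 2 * 0 / \<rho>"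
    using \<rho>_bounds by (intro tendsto_intros dE_tendsto_0 assms) auto
  then have "Inf S \<le> 2 * 0 / \<rho>"
    by (rule tendsto_lowerbound) (use ev bdd in \<open>auto elim: eventually_mono intro: cInf_lower\<close>)
  moreover have "S \<noteq> {}"
    using eventually_happens[OF ev] by auto
  then have "0 \<le> Inf S" by (rule cInf_greatest) (auto simp: S_def)
  ultimately show ?thesis by (simp add: kobayashi_royden_def S_def)
qed

end

section \<open>The plurisubharmonic function\<close>

context henon_sequence
begin

definition \<psi> :: "nat \<Rightarrow> c2 \<Rightarrow> real" where "\<psi> n p = (ln (M n p) + ln C) / real d ^ n"

text \<open>The floor \<open>\<eta> n\<close> in \<open>M n\<close> keeps every
  \<open>\<psi> n\<close> at or above \<open>ln a\<close>. Hence the infimum is a real number and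
  the limit of the sequence.\<close>

definition u :: "c2 \<Rightarrow> real" where "u p = (INF n. \<psi> n p)"

lemma ln_C_nonneg: "0 \<le> ln C" using C_ge_4 by simp

lemma d_power_pos: "0 < real d ^ n" using d_ge_2 by simp

text \<open>One map costs an additive \<open>ln C\<close>. The summand \<open>ln C\<close> in
  \<open>\<psi>\<close> pays for it, because \<open>2 * ln C \<le> d * ln C\<close>.\<close>

lemma \<psi>_Suc_le: "\<psi> (Suc n) p \<le> \<psi> n p"
proof -
  have "ln (M (Suc n) p) \<le> ln (C * M n p ^ d)"
    using M_Suc[of n p] M_pos[of "Suc n" p] by (intro ln_mono) auto
  also have "\<dots> = ln C + d * ln (M n p)"
    using C_ge_4 M_pos[of n p] by (simp add: ln_mult ln_realpow)
  finally have "ln (M (Suc n) p) + ln C \<le> 2 * ln C + d * ln (M n p)" by simp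
  also have "\<dots> \<le> d * ln C + d * ln (M n p)"
    using d_ge_2 ln_C_nonneg by (intro add_right_mono mult_right_mono) auto
  finally have "(ln (M (Suc n) p) + ln C) / real d ^ Suc n
      \<le> (d * (ln (M n p) + ln C)) / real d ^ Suc n"
    using d_power_pos[of "Suc n"] by (intro divide_right_mono) (auto simp: algebra_simps)
  then show ?thesis using d_ge_2 by (simp add: \<psi>_def)
qed

lemma decseq_\<psi>: "decseq (\<lambda>n. \<psi> n p)"
  by (rule decseq_SucI) (rule \<psi>_Suc_le)

lemma ln_\<eta>: "ln (\<eta> n) = real d ^ n * ln a"
  using a_pos by (simp add: \<eta>_def ln_realpow)

lemma \<psi>_ge: "ln a \<le> \<psi> n p"
proof -
  have "ln (\<eta> n) \<le> ln (M n p)"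
    using \<eta>_pos by (intro ln_mono) (auto simp: M_def)
  then show ?thesis
    using d_power_pos[of n] ln_C_nonneg by (simp add: \<psi>_def ln_\<eta> field_simps)
qed

lemma bdd_below_\<psi>: "bdd_below (range (\<lambda>n. \<psi> n p))"
  by (rule bdd_belowI2) (rule \<psi>_ge)

lemma u_le_\<psi>: "u p \<le> \<psi> n p"
  unfolding u_def by (rule cINF_lower[OF bdd_below_\<psi>]) simp

lemma \<psi>_tendsto_u: "(\<lambda>n. \<psi> n p) \<longlonglongrightarrow> u p"
  unfolding u_def by (rule LIMSEQ_decseq_INF[OF bdd_below_\<psi> decseq_\<psi>])

lemma u_less_iff: "u p < c \<longleftrightarrow> (\<exists>n. \<psi> n p < c)"
  unfolding u_def using cINF_less_iff[OF _ bdd_below_\<psi>] by blast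

lemma continuous_on_M: "continuous_on S (M n)"
  unfolding M_def[abs_def] by (intro continuous_intros aut2_continuous[OF aut2_E])

lemma continuous_on_\<psi>: "continuous_on S (\<psi> n)"
proof -
  have "continuous_on S (\<lambda>p. (ln (M n p) + ln C) * (1 / real d ^ n))"
    using M_pos by (intro continuous_intros continuous_on_M) (auto simp: less_imp_neq[symmetric])
  then show ?thesis by (simp add: \<psi>_def[abs_def])
qed

lemma continuous_on_\<psi>_circle: "continuous_on S (\<lambda>\<theta>. \<psi> n (x + cmul (cis \<theta>) b))"
  by (rule continuous_on_compose2[OF continuous_on_\<psi>[of UNIV]])
     (auto intro!: continuous_intros)

text \<open>On a complex line \<open>M n\<close> is the maximum of the moduli of three entire
  functions: the two components of \<open>E n\<close> and the constant \<open>\<eta> n\<close>. The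
  constant also makes \<open>ln (M n)\<close> continuous, so \<open>log_submean\<close> applies to
  each of the three with the same majorant.\<close>

lemma \<psi>_submean:
  "\<psi> n x \<le> 1 / (2 * pi) * integral {0..2*pi} (\<lambda>\<theta>. \<psi> n (x + cmul (cis \<theta>) b))"
proof -
  let ?v = "\<lambda>\<zeta>. ln (M n (x + cmul \<zeta> b))"
  let ?I = "1 / (2 * pi) * integral {0..2*pi} (\<lambda>\<theta>. ?v (cis \<theta>))"
  have v: "continuous_on S ?v" for S
    using M_pos by (intro continuous_intros continuous_on_compose2[OF continuous_on_M[of UNIV]])
      (auto intro!: continuous_intros simp: less_imp_neq[symmetric])
  have le: "norm (f 0) \<le> exp ?I"
    if "f holomorphic_on UNIV" "\<And>\<zeta>. norm (f \<zeta>) \<le> M n (x + cmul \<zeta> b)" for f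
    using that M_pos by (intro log_submean[OF that(1) v]) auto
  have "norm (fst (E n (x + cmul 0 b))) \<le> exp ?I" "norm (snd (E n (x + cmul 0 b))) \<le> exp ?I"
    using aut2_E[of n] unfolding aut2_def
    by (intro le[of "\<lambda>\<zeta>. fst (E n (x + cmul \<zeta> b))"] le[of "\<lambda>\<zeta>. snd (E n (x + cmul \<zeta> b))"]
        holo2_on_line_holomorphic; simp add: M_def maxnorm_def)+
  moreover have "norm (of_real (\<eta> n) :: complex) \<le> exp ?I"
    using \<eta>_pos[of n] by (intro le[of "\<lambda>_. of_real (\<eta> n)"]) (auto simp: M_def)
  ultimately have "M n x \<le> exp ?I"
    using \<eta>_pos[of n] by (simp add: M_def maxnorm_def)
  then have "ln (M n x) \<le> ?I"
    using M_pos[of n x] by (simp add: ln_le_cancel_iff[symmetric] del: ln_le_cancel_iff)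
  have int: "(\<lambda>\<theta>. ?v (cis \<theta>)) integrable_on {0..2*pi}"
    by (intro integrable_continuous_real continuous_on_compose2[OF v[of UNIV]] continuous_intros) auto
  have "((\<lambda>\<theta>. (?v (cis \<theta>) + ln C) / real d ^ n) has_integral
      (integral {0..2*pi} (\<lambda>\<theta>. ?v (cis \<theta>)) + 2 * pi * ln C) / real d ^ n) {0..2*pi}"
    using has_integral_const_real[of "ln C" 0 "2*pi"]
    by (intro has_integral_divide has_integral_add integrable_integral[OF int]) auto
  then have "integral {0..2*pi} (\<lambda>\<theta>. \<psi> n (x + cmul (cis \<theta>) b))
      = (integral {0..2*pi} (\<lambda>\<theta>. ?v (cis \<theta>)) + 2 * pi * ln C) / real d ^ n"
    unfolding \<psi>_def by (rule integral_unique)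
  then have "1 / (2 * pi) * integral {0..2*pi} (\<lambda>\<theta>. \<psi> n (x + cmul (cis \<theta>) b))
      = (?I + ln C) / real d ^ n"
    using d_power_pos[of n] by (simp add: field_simps)
  then show ?thesis
    using \<open>ln (M n x) \<le> ?I\<close> d_power_pos[of n] unfolding \<psi>_def by (simp add: divide_right_mono)
qed

lemma u_submean:
  "u x \<le> 1 / (2 * pi) * integral {0..2*pi} (\<lambda>\<theta>. max (u (x + cmul (cis \<theta>) b)) c)"
proof -
  let ?f = "\<lambda>n \<theta>. max (\<psi> n (x + cmul (cis \<theta>) b)) c"
  have int: "?f n integrable_on {0..2*pi}" for n
    by (intro integrable_continuous_real continuous_intros continuous_on_\<psi>_circle)
  have "(\<lambda>n. integral {0..2*pi} (?f n)) \<longlonglongrightarrow>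
      integral {0..2*pi} (\<lambda>\<theta>. max (u (x + cmul (cis \<theta>) b)) c)"
  proof (rule dominated_convergence(2)[OF int])
    \<comment> \<open>All truncated approximants lie between \<open>c\<close> and the first of
      them.\<close>
    show "(\<lambda>\<theta>. \<bar>c\<bar> + \<bar>?f 0 \<theta>\<bar>) integrable_on {0..2*pi}"
      by (intro integrable_continuous_real continuous_intros continuous_on_\<psi>_circle)
    show "norm (?f n \<theta>) \<le> \<bar>c\<bar> + \<bar>?f 0 \<theta>\<bar>" for n \<theta>
      using decseqD[OF decseq_\<psi>, of 0 n "x + cmul (cis \<theta>) b"] by auto
    show "(\<lambda>n. ?f n \<theta>) \<longlonglongrightarrow> max (u (x + cmul (cis \<theta>) b)) c" for \<theta>
      by (intro tendsto_intros \<psi>_tendsto_u)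
  qed
  then have "(\<lambda>n. 1 / (2 * pi) * integral {0..2*pi} (?f n)) \<longlonglongrightarrow>
      1 / (2 * pi) * integral {0..2*pi} (\<lambda>\<theta>. max (u (x + cmul (cis \<theta>) b)) c)"
    by (intro tendsto_intros)
  moreover have "u x \<le> 1 / (2 * pi) * integral {0..2*pi} (?f n)" for n
  proof -
    have "u x \<le> 1 / (2 * pi) * integral {0..2*pi} (\<lambda>\<theta>. \<psi> n (x + cmul (cis \<theta>) b))"
      using u_le_\<psi> \<psi>_submean by (rule order_trans)
    also have "\<dots> \<le> 1 / (2 * pi) * integral {0..2*pi} (?f n)"
      by (intro mult_left_mono integral_le int integrable_continuous_real continuous_on_\<psi>_circle) auto
    finally show ?thesis .
  qed
  ultimately show ?thesis by (intro LIMSEQ_le_const) auto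
qed

lemma psh2_u: "psh2 U (\<lambda>p. ereal (u p))"
proof -
  have "openin (top_of_set U) {x \<in> U. ereal (u x) < ereal c}" for c
  proof -
    have "open (\<Union>n. {x. \<psi> n x < c})"
      using continuous_on_\<psi>[of UNIV] by (intro open_UN ballI open_Collect_less) auto
    moreover have "{x \<in> U. ereal (u x) < ereal c} = U \<inter> (\<Union>n. {x. \<psi> n x < c})"
      by (auto simp: u_less_iff)
    ultimately show ?thesis by (auto intro: openin_open_Int)
  qed
  moreover have "real_of_ereal (max (ereal y) (ereal c)) = max y c" for y c
    by (simp add: max_def)
  ultimately show ?thesis
    unfolding psh2_def using u_submean by simp
qed

text \<open>A single late approximant suffices: once the orbit is trapped, \<open>C * M n p\<close>
  is at most \<open>C * \<rho> = 1/8\<close>.\<close>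

lemma u_nonpos_on_basin:
  assumes "p \<in> basin H"
  shows "u p \<le> 0"
proof -
  obtain n where n: "N \<le> n" "norm (E n p) < \<rho>"
    using eventually_happens[OF eventually_conj[OF eventually_ge_at_top[of N]
        basin_eventually_less[OF assms \<rho>_bounds(1)]]] by auto
  then have "M n p \<le> \<rho>" using M_le_\<rho>_iff[of n p] maxnorm_le_norm[of "E n p"] by simp
  then have "C * M n p \<le> 1"
    using C_\<rho> C_ge_4 mult_left_mono[of "M n p" \<rho> C] by linarith
  then have "ln (C * M n p) \<le> 0" using C_ge_4 M_pos[of n p] by simp
  then have "\<psi> n p \<le> 0"
    using C_ge_4 M_pos[of n p] d_power_pos[of n] by (simp add: \<psi>_def ln_mult divide_le_0_iff add.commute)
  then show ?thesis using u_le_\<psi>[of p n] by simp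
qed

lemma u_nonconstant: "\<exists>x\<in>basin H. \<exists>y\<in>basin H. u x \<noteq> u y"
proof -
  \<comment> \<open>\<open>\<beta>\<close> obeys the same recursion as \<open>\<eta>\<close>, but
    the perturbations, of size \<open>\<eta> = \<beta>\<^sup>2\<close>, are of higher order compared
    with it.\<close>
  define \<beta> where "\<beta> m = sqrt (\<eta> m)" for m
  have \<beta>_pos: "0 < \<beta> m" and \<beta>_sq: "\<beta> m * \<beta> m = \<eta> m" and \<beta>_Suc: "\<beta> (Suc m) = \<beta> m ^ d" for m
    using \<eta>_pos[of m] by (auto simp: \<beta>_def \<eta>_Suc real_sqrt_power)
  have ln_a: "ln a < 0" using a_pos a_less_1 by simp
  have "(\<lambda>n. sqrt (\<eta> n)) \<longlonglongrightarrow> sqrt 0"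
    by (intro tendsto_intros \<eta>_tendsto_0)
  then have ev1: "\<forall>\<^sub>F n in sequentially. \<beta> n < \<rho> / 2"
    using \<rho>_bounds by (intro order_tendstoD) (auto simp: \<beta>_def)
  have "(\<lambda>n. ln C / real d ^ n) \<longlonglongrightarrow> 0"
    using d_ge_2 by (intro LIMSEQ_divide_realpow_zero) auto
  then have ev2: "\<forall>\<^sub>F n in sequentially. ln C / real d ^ n < - ln a / 2"
    using ln_a by (intro order_tendstoD) auto
  \<comment> \<open>The three conditions make trapping available, put the starting value
    \<open>2 * \<beta> n\<close> of \<open>x\<close> below \<open>\<rho>\<close>, and bring
    \<open>\<psi> n\<close> at the preimage of the origin below \<open>ln a / 2\<close>.\<close>
  obtain n where n: "N \<le> n" "\<beta> n < \<rho> / 2" "ln C / real d ^ n < - ln a / 2"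
    using eventually_happens[OF eventually_conj[OF eventually_ge_at_top[of N] eventually_conj[OF ev1 ev2]]]
    by auto
  define y where "y = E_inv n 0"
  have "M n y = \<eta> n" using \<eta>_pos[of n] by (simp add: M_def y_def maxnorm_def)
  then have "\<psi> n y = ln a + ln C / real d ^ n"
    using d_power_pos[of n] by (simp add: \<psi>_def ln_\<eta> add_divide_distrib)
  then have u_y: "u y < ln a / 2" using n(3) u_le_\<psi>[of y n] by simp
  have "y \<in> basin H"
    using \<rho>_bounds by (intro basinI[OF n(1)]) (simp add: y_def maxnorm_def)
  define x where "x = E_inv n (of_real (2 * \<beta> n), 0)"
  have x_small: "maxnorm (E n x) \<le> \<rho>"
    using n(2) \<beta>_pos[of n] by (simp add: x_def maxnorm_def norm_mult)
  have small: "maxnorm (E (n + k) x) \<le> \<rho>" for k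
    using trapped[OF n(1) x_small, of "n + k"] x_small \<rho>_bounds by (cases "k = 0") auto
  \<comment> \<open>The factor 2 carries the induction: since \<open>d\<close> is at least 2, the
    leading power has modulus at least four times the next \<open>\<beta>\<close>, and the
    perturbation removes at most twice the next \<open>\<beta>\<close>.\<close>
  have lower: "2 * \<beta> (n + k) \<le> norm (fst (E (n + k) x)) \<and> \<beta> (n + k) \<le> \<rho> / 2" for k
  proof (induction k)
    case 0
    then show ?case using n(2) \<beta>_pos[of n] by (simp add: x_def norm_mult)
  next
    case (Suc k)
    let ?m = "n + k"
    let ?z = "fst (E ?m x)" and ?w = "snd (E ?m x)" and ?\<beta> = "\<beta> (Suc ?m)"
    have z: "norm ?z \<le> 1" and w: "norm ?w \<le> 1"
      using small[of k] \<rho>_bounds by (auto simp: maxnorm_def)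
    have "\<beta> ?m \<le> 1" using Suc \<rho>_bounds by linarith
    then have "?\<beta> \<le> \<beta> ?m"
      unfolding \<beta>_Suc using d_ge_2 \<beta>_pos[of ?m] power_decreasing[of 1 d "\<beta> ?m"] by simp
    then have \<beta>_le: "?\<beta> \<le> \<rho> / 2" using Suc by linarith
    have "C * ?\<beta> \<le> C * \<rho>"
      using \<beta>_le \<rho>_bounds C_ge_4 by (intro mult_left_mono) auto
    then have "(d + 1) * ?\<beta> \<le> 2"
      using \<beta>_pos[of "Suc ?m"] unfolding C_\<rho> by (simp add: C_def algebra_simps)
    then have "(d + 1) * ?\<beta> * ?\<beta> \<le> 2 * ?\<beta>"
      using \<beta>_pos[of "Suc ?m"] by (intro mult_right_mono) auto
    then have err: "(d + 1) * \<eta> (Suc ?m) \<le> 2 * ?\<beta>"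
      using \<beta>_sq[of "Suc ?m"] by (simp add: mult.assoc)
    have "2 ^ 2 * ?\<beta> \<le> 2 ^ d * ?\<beta>"
      using d_ge_2 \<beta>_pos[of "Suc ?m"] by (intro mult_right_mono power_increasing) auto
    also have "\<dots> = (2 * \<beta> ?m) ^ d" by (simp add: \<beta>_Suc power_mult_distrib)
    also have "\<dots> \<le> norm ?z ^ d" using Suc \<beta>_pos[of ?m] by (intro power_mono) auto
    finally have zd: "4 * ?\<beta> \<le> norm (?z ^ d)" by (simp add: norm_power)
    have "norm (\<delta> (Suc ?m) * ?w) \<le> \<eta> (Suc ?m) * 1"
      unfolding norm_mult using \<delta>_le_\<eta>[of "Suc ?m"] \<eta>_pos[of "Suc ?m"] w by (intro mult_mono) auto
    then have "norm (poly (q (Suc ?m)) ?z + \<delta> (Suc ?m) * ?w) \<le> (d + 1) * \<eta> (Suc ?m)"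
      using norm_q_le[of "Suc ?m" ?z] z
      by (intro order_trans[OF norm_triangle_ineq]) (simp add: algebra_simps)
    moreover have "norm (?z ^ d) - norm (poly (q (Suc ?m)) ?z + \<delta> (Suc ?m) * ?w)
        \<le> norm (fst (E (Suc ?m) x))"
      using norm_diff_ineq[of "?z ^ d" "poly (q (Suc ?m)) ?z + \<delta> (Suc ?m) * ?w"]
      by (simp add: E_Suc H_def henonF_def add.assoc)
    ultimately have "2 * ?\<beta> \<le> norm (fst (E (Suc ?m) x))" using zd err by linarith
    then show ?case using \<beta>_le by simp
  qed
  have "ln a / 2 \<le> \<psi> (n + k) x" for k
  proof -
    let ?m = "n + k"
    have "\<beta> ?m \<le> norm (fst (E ?m x))" using lower[of k] \<beta>_pos[of ?m] by linarith
    then have "\<beta> ?m \<le> M ?m x" by (simp add: M_def maxnorm_def le_max_iff_disj)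
    then have "ln (\<beta> ?m) \<le> ln (M ?m x)" using \<beta>_pos[of ?m] by simp
    moreover have "ln (\<beta> ?m) = real d ^ ?m * (ln a / 2)"
      using \<eta>_pos[of ?m] by (simp add: \<beta>_def ln_sqrt ln_\<eta>)
    ultimately show ?thesis
      using ln_C_nonneg d_power_pos[of ?m] by (simp add: \<psi>_def field_simps)
  qed
  then have "ln a / 2 \<le> u x"
    by (intro LIMSEQ_le_const[OF LIMSEQ_ignore_initial_segment[OF \<psi>_tendsto_u, of n]])
       (simp add: add.commute)
  then have "u x \<noteq> u y" using u_y by linarith
  moreover have "x \<in> basin H" by (rule basinI[OF n(1) x_small])
  ultimately show ?thesis using \<open>y \<in> basin H\<close> by blast
qed

lemma short_C2_basin: "short_C2 (basin H)"
  unfolding short_C2_def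
proof (intro conjI ballI allI)
  show "\<exists>D. (\<forall>n. domain2 (D n) \<and> biholomorphic2 (D n) unit_ball2 \<and> D n \<subseteq> D (Suc n)) \<and>
      basin H = (\<Union>n. D n)"
    using exhaustion_ball_biholomorphic exhaustion_ball_mono basin_eq_Union_balls by blast
  show "kobayashi_royden (basin H) p v = 0" if "p \<in> basin H" for p v
    by (rule kobayashi_royden_basin[OF that])
  show "\<exists>u. psh2 (basin H) u \<and> (\<exists>x\<in>basin H. \<exists>y\<in>basin H. u x \<noteq> u y) \<and>
      (\<exists>M::real. \<forall>x\<in>basin H. u x \<le> ereal M)"
    using psh2_u[of "basin H"] u_nonconstant u_nonpos_on_basin
    by (intro exI[of _ "\<lambda>p. ereal (u p)"] conjI) (auto intro!: exI[of _ 0])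
qed

end

section \<open>The Loewner family\<close>

text \<open>This and the next lemma supply the one-sided conditions of
  \<open>loewner_family\<close>. Continuity is given on \<open>{0..1}\<close> only, so the nearby
  point is clamped to that interval.\<close>

lemma continuous_less_left:
  fixes f :: "real \<Rightarrow> real"
  assumes "continuous_on {0..1} f" "0 < \<tau>" "\<tau> \<le> 1" "f \<tau> < c"
  shows "\<exists>\<tau>'\<in>{0..<\<tau>}. f \<tau>' < c"
proof -
  obtain e where e: "e > 0" "\<And>x. x \<in> {0..1} \<Longrightarrow> dist x \<tau> < e \<Longrightarrow> dist (f x) (f \<tau>) < c - f \<tau>"
    using assms(1)[unfolded continuous_on_iff, rule_format, of \<tau> "c - f \<tau>"] assms by auto
  let ?x = "max 0 (\<tau> - e / 2)"
  have "dist (f ?x) (f \<tau>) < c - f \<tau>"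
    using assms e(1) by (intro e(2)) (auto simp: dist_real_def)
  then have "f ?x < c" by (auto simp: dist_real_def abs_less_iff)
  then show ?thesis using assms e(1) by (intro bexI[of _ ?x]) auto
qed

lemma continuous_le_right:
  fixes f :: "real \<Rightarrow> real"
  assumes "continuous_on {0..1} f" "0 \<le> \<tau>" "\<tau> < 1" "\<And>x. \<tau> < x \<Longrightarrow> x \<le> 1 \<Longrightarrow> f x < c"
  shows "f \<tau> \<le> c"
proof (rule ccontr)
  assume "\<not> f \<tau> \<le> c"
  then obtain e where e: "e > 0" "\<And>x. x \<in> {0..1} \<Longrightarrow> dist x \<tau> < e \<Longrightarrow> dist (f x) (f \<tau>) < f \<tau> - c"
    using assms(1)[unfolded continuous_on_iff, rule_format, of \<tau> "f \<tau> - c"] assms by auto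
  let ?x = "min 1 (\<tau> + e / 2)"
  have "dist (f ?x) (f \<tau>) < f \<tau> - c"
    using assms e(1) by (intro e(2)) (auto simp: dist_real_def)
  moreover have "f ?x < c" using assms e(1) by (intro assms(4)) auto
  ultimately show False by (simp add: dist_real_def)
qed

context henon_sequence
begin

text \<open>\<open>H k\<close> maps the polydisc of radius \<open>\<rho>\<close> onto the tube
  \<open>{(z,w). |w| < |\<delta>\<^sub>k| \<rho>, |z - h k w| < |\<delta>\<^sub>k| \<rho>}\<close>. The tubes \<open>|w| < R k \<tau>\<close>, \<open>|z - s \<tau> h k w| < r k \<tau>\<close>
  first straighten it while fattening the fibres (\<open>\<tau> \<le> 1/2\<close>) and then grow to the polydisc itself;
  \<open>T k \<tau>\<close> maps them onto the unit polydisc.\<close>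

definition h :: "nat \<Rightarrow> complex \<Rightarrow> complex" where
  "h k w = (w / \<delta> k) ^ d + poly (q k) (w / \<delta> k)"

text \<open>Up to \<open>\<tau> = 1/2\<close> the first argument of \<open>max\<close> governs and
  keeps the radius within \<open>3/2 * \<rho> * norm (\<delta> k)\<close>, where \<open>h k\<close>
  is small; the second lifts it to \<open>\<rho>\<close> at \<open>\<tau> = 1\<close>. Both
  arguments increase strictly.\<close>

definition R :: "nat \<Rightarrow> real \<Rightarrow> real" where
  "R k \<tau> = \<rho> * max (norm (\<delta> k) * (1 + \<tau>)) (2 * \<tau> - 1)"

definition r :: "nat \<Rightarrow> real \<Rightarrow> real" where
  "r k \<tau> = \<rho> * (norm (\<delta> k) + \<tau> * (1 - norm (\<delta> k)))"

definition s :: "real \<Rightarrow> real" where "s \<tau> = max 0 (1 - 2 * \<tau>)"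

definition T :: "nat \<Rightarrow> real \<Rightarrow> c2 \<Rightarrow> c2" where
  "T k \<tau> p = ((fst p - of_real (s \<tau>) * h k (snd p)) / of_real (r k \<tau>), snd p / of_real (R k \<tau>))"

definition T_inv :: "nat \<Rightarrow> real \<Rightarrow> c2 \<Rightarrow> c2" where
  "T_inv k \<tau> p = (of_real (r k \<tau>) * fst p + of_real (s \<tau>) * h k (of_real (R k \<tau>) * snd p),
     of_real (R k \<tau>) * snd p)"

lemma norm_\<delta>_bounds:
  assumes "N < k" shows "0 < norm (\<delta> k)" "norm (\<delta> k) \<le> \<rho>\<^sup>2" "norm (\<delta> k) \<le> 1/4"
proof -
  show "0 < norm (\<delta> k)" using \<delta>_nonzero[of k] assms by simp
  show "norm (\<delta> k) \<le> \<rho>\<^sup>2" using \<delta>_le_\<eta>[of k] \<eta>_le_\<rho>2[of k] assms by simp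
  show "norm (\<delta> k) \<le> 1/4" using \<delta>_le_\<eta>[of k] \<eta>_le_\<rho>[of k] \<rho>_bounds assms by simp
qed

lemma R_pos: "N < k \<Longrightarrow> 0 \<le> \<tau> \<Longrightarrow> 0 < R k \<tau>"
  using norm_\<delta>_bounds[of k] \<rho>_bounds by (simp add: R_def less_max_iff_disj)

lemma r_pos: "N < k \<Longrightarrow> 0 \<le> \<tau> \<Longrightarrow> 0 < r k \<tau>"
  using norm_\<delta>_bounds[of k] \<rho>_bounds by (simp add: r_def add_pos_nonneg)

lemma aut2_T:
  assumes "N < k" "0 \<le> \<tau>" shows "aut2 (T k \<tau>) (T_inv k \<tau>)"
proof -
  have \<delta>: "\<delta> k \<noteq> 0" using norm_\<delta>_bounds[OF assms(1)] by auto
  have h: "(\<lambda>w. h k (f w)) holomorphic_on UNIV" if "f holomorphic_on UNIV" for f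
    unfolding h_def using \<delta> that by (intro holomorphic_intros) auto
  have nz: "R k \<tau> \<noteq> 0" "r k \<tau> \<noteq> 0" using R_pos[OF assms] r_pos[OF assms] by auto
  have "holo2_on (\<lambda>p. (fst p / of_real (r k \<tau>) + - (of_real (s \<tau>) * h k (snd p)) / of_real (r k \<tau>),
      0 + snd p / of_real (R k \<tau>))) UNIV"
    using nz by (intro holo2_on_separated holomorphic_intros h) auto
  then have "holo2_on (T k \<tau>) UNIV"
    by (simp add: T_def[abs_def] diff_divide_distrib)
  moreover have "holo2_on (\<lambda>p. (of_real (r k \<tau>) * fst p +
      of_real (s \<tau>) * h k (of_real (R k \<tau>) * snd p), 0 + of_real (R k \<tau>) * snd p)) UNIV"
    by (intro holo2_on_separated holomorphic_intros h)
  then have "holo2_on (T_inv k \<tau>) UNIV"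
    by (simp add: T_inv_def[abs_def])
  ultimately show ?thesis
    using nz by (simp add: aut2_def T_def T_inv_def)
qed

lemma maxnorm_T:
  assumes "N < k" "0 \<le> \<tau>"
  shows "maxnorm (T k \<tau> p) =
    max (norm (fst p - of_real (s \<tau>) * h k (snd p)) / r k \<tau>) (norm (snd p) / R k \<tau>)"
  using R_pos[OF assms] r_pos[OF assms] by (simp add: maxnorm_def T_def norm_divide)

lemma maxnorm_T_1: "N < k \<Longrightarrow> maxnorm (T k 1 p) = maxnorm p / \<rho>"
  using norm_\<delta>_bounds[of k] \<rho>_bounds
  by (subst maxnorm_T) (auto simp: s_def r_def R_def maxnorm_def max_divide_distrib_right)

text \<open>Since \<open>s 0 = 1\<close>, the shear undoes \<open>H k\<close> up to a swap of
  coordinates and the factor \<open>\<delta> k\<close>, which both radii cancel. With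
  \<open>maxnorm_T_1\<close> this makes the end of one stage the start of the next.\<close>

lemma maxnorm_T_0:
  assumes "N < k" shows "maxnorm (T k 0 (H k p)) = maxnorm p / \<rho>"
proof -
  have \<delta>: "\<delta> k \<noteq> 0" using norm_\<delta>_bounds[OF assms] by auto
  have "max (norm (\<delta> k)) (- 1) = norm (\<delta> k)"
    by (intro max_absorb1) (use norm_ge_zero[of "\<delta> k"] in linarith)
  then have "R k 0 = \<rho> * norm (\<delta> k)" by (simp add: R_def)
  then show ?thesis
    unfolding maxnorm_T[OF assms order_refl] using \<delta> \<rho>_bounds
    by (simp add: s_def r_def H_def henonF_def h_def norm_mult maxnorm_def
        max_divide_distrib_right max.commute)
qed

lemma continuous_on_maxnorm_T:
  assumes "N < k" shows "continuous_on {0..1} (\<lambda>\<tau>. maxnorm (T k \<tau> p))"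
proof -
  have "continuous_on {0..1} (r k)" "continuous_on {0..1} (R k)" "continuous_on {0..1} s"
    unfolding r_def[abs_def] R_def[abs_def] s_def[abs_def] by (intro continuous_intros)+
  moreover have "\<forall>\<tau>\<in>{0..1}. r k \<tau> \<noteq> 0" "\<forall>\<tau>\<in>{0..1}. R k \<tau> \<noteq> 0"
    using R_pos[OF assms] r_pos[OF assms] by fastforce+
  ultimately have "continuous_on {0..1} (\<lambda>\<tau>. max (norm (fst p - of_real (s \<tau>) * h k (snd p)) / r k \<tau>)
      (norm (snd p) / R k \<tau>))"
    by (intro continuous_intros)
  then show ?thesis
    by (rule continuous_on_eq) (simp add: maxnorm_T[OF assms])
qed

text \<open>Here \<open>w / \<delta> k\<close> has modulus at most \<open>3/2 * \<rho>\<close>, so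
  the power and the polynomial are both of order \<open>\<rho>\<^sup>2\<close>; then
  \<open>9/4 + d \<le> 2 * C\<close> and \<open>C * \<rho> = 1/8\<close> give the bound.\<close>

lemma norm_h_le:
  assumes "N < k" "norm w \<le> 3/2 * (\<rho> * norm (\<delta> k))"
  shows "norm (h k w) \<le> \<rho> / 4"
proof -
  let ?x = "w / \<delta> k"
  have x: "norm ?x \<le> 3/2 * \<rho>"
    using assms(2) norm_\<delta>_bounds[OF assms(1)] by (simp add: norm_divide field_simps)
  then have x1: "norm ?x \<le> 1" using \<rho>_bounds by linarith
  have "norm (?x ^ d) \<le> norm ?x ^ 2"
    unfolding norm_power using x1 d_ge_2 by (intro power_decreasing) auto
  also have "\<dots> \<le> (3/2 * \<rho>)\<^sup>2" using x by (intro power_mono) auto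
  also have "\<dots> = 9/4 * \<rho>\<^sup>2" by (simp add: power2_eq_square)
  finally have "norm (?x ^ d) \<le> 9/4 * \<rho>\<^sup>2" .
  moreover have "norm (poly (q k) ?x) \<le> d * \<rho>\<^sup>2"
    using norm_q_le[of k ?x] x1 \<eta>_le_\<rho>2[of k] assms(1) mult_left_mono[of "\<eta> k" "\<rho>\<^sup>2" "real d"]
    by linarith
  ultimately have "norm (h k w) \<le> 9/4 * \<rho>\<^sup>2 + d * \<rho>\<^sup>2"
    unfolding h_def by (intro order_trans[OF norm_triangle_ineq] add_mono)
  also have "\<dots> = (9/4 + d) * \<rho>\<^sup>2" by (simp add: algebra_simps)
  also have "\<dots> \<le> 2 * C * \<rho>\<^sup>2" by (intro mult_right_mono) (auto simp: C_def)
  also have "\<dots> = 2 * (C * \<rho>) * \<rho>" by (simp add: power2_eq_square)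
  also have "\<dots> = \<rho> / 4" by (simp add: C_\<rho>)
  finally show ?thesis .
qed

text \<open>While the tube is being straightened, the centre of a fibre moves at speed at most
  \<open>2 * (\<rho> / 4)\<close>, and its radius grows at speed
  \<open>\<rho> * (1 - norm (\<delta> k))\<close>, at least \<open>3/4 * \<rho>\<close>. For
  \<open>\<tau> \<ge> 1/2\<close> the centre is at rest.\<close>

lemma maxnorm_T_less:
  assumes k: "N < k" and \<tau>: "0 \<le> \<tau>" "\<tau> < \<tau>'" and le: "maxnorm (T k \<tau> p) \<le> 1"
  shows "maxnorm (T k \<tau>' p) < 1"
proof -
  let ?e = "norm (\<delta> k)" and ?h = "h k (snd p)"
  have \<tau>': "0 \<le> \<tau>'" using \<tau> by simp
  note e = norm_\<delta>_bounds[OF k]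
  have w: "norm (snd p) \<le> R k \<tau>" and z: "norm (fst p - of_real (s \<tau>) * ?h) \<le> r k \<tau>"
    using le R_pos[OF k \<tau>(1)] r_pos[OF k \<tau>(1)] by (auto simp: maxnorm_T[OF k \<tau>(1)])
  have "R k \<tau> < R k \<tau>'"
  proof -
    have "?e * (1 + \<tau>) < ?e * (1 + \<tau>')" using \<tau> e(1) by (intro mult_strict_left_mono) auto
    then have "max (?e * (1 + \<tau>)) (2 * \<tau> - 1) < max (?e * (1 + \<tau>')) (2 * \<tau>' - 1)"
      unfolding max_less_iff_conj less_max_iff_disj using \<tau> by linarith
    then show ?thesis unfolding R_def using \<rho>_bounds(1) by (rule mult_strict_left_mono)
  qed
  moreover have "norm (fst p - of_real (s \<tau>') * ?h) < r k \<tau>'"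
  proof -
    have "(s \<tau> - s \<tau>') * norm ?h \<le> (\<tau>' - \<tau>) * (\<rho> / 2)"
    proof (cases "\<tau> < 1/2")
      case True
      have "R k \<tau> \<le> 3/2 * (\<rho> * ?e)"
      proof -
        have "max (?e * (1 + \<tau>)) (2 * \<tau> - 1) \<le> ?e * (3/2)"
        proof (rule max.boundedI)
          show "2 * \<tau> - 1 \<le> ?e * (3/2)"
            using True e(1) by linarith
          show "?e * (1 + \<tau>) \<le> ?e * (3/2)"
            using True by (intro mult_left_mono) auto
        qed
        then have "R k \<tau> \<le> \<rho> * (?e * (3/2))"
          unfolding R_def using \<rho>_bounds by (intro mult_left_mono) auto
        then show ?thesis by simp
      qed
      then have "norm ?h \<le> \<rho> / 4" using w by (intro norm_h_le[OF k]) simp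
      then have "(s \<tau> - s \<tau>') * norm ?h \<le> (2 * (\<tau>' - \<tau>)) * (\<rho> / 4)"
        using \<tau> by (intro mult_mono) (auto simp: s_def)
      then show ?thesis by (simp add: field_simps)
    next
      case False
      then show ?thesis using \<tau> \<rho>_bounds by (simp add: s_def)
    qed
    also have "\<dots> < (\<tau>' - \<tau>) * (\<rho> * (1 - ?e))"
      using \<tau> \<rho>_bounds e by (intro mult_strict_left_mono) auto
    also have "\<dots> = r k \<tau>' - r k \<tau>" by (simp add: r_def algebra_simps)
    finally have *: "(s \<tau> - s \<tau>') * norm ?h < r k \<tau>' - r k \<tau>" .
    have "s \<tau>' \<le> s \<tau>" using \<tau> by (simp add: s_def)
    then have **: "norm (of_real (s \<tau> - s \<tau>') * ?h) = (s \<tau> - s \<tau>') * norm ?h"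
      unfolding norm_mult norm_of_real by simp
    have shift: "fst p - of_real (s \<tau>') * ?h
        = (fst p - of_real (s \<tau>) * ?h) + of_real (s \<tau> - s \<tau>') * ?h"
      by (simp add: algebra_simps)
    have "norm (fst p - of_real (s \<tau>') * ?h) \<le> r k \<tau> + (s \<tau> - s \<tau>') * norm ?h"
      unfolding shift using ** z norm_triangle_ineq[of "fst p - of_real (s \<tau>) * ?h" "of_real (s \<tau> - s \<tau>') * ?h"]
      by linarith
    then show ?thesis using * by linarith
  qed
  ultimately show ?thesis
    using w R_pos[OF k \<tau>'] r_pos[OF k \<tau>'] by (simp add: maxnorm_T[OF k \<tau>'])
qed

section \<open>Concatenation of the tube families over all times\<close>

definition stage :: "real \<Rightarrow> nat" where "stage t = Suc (N + nat \<lfloor>t\<rfloor>)"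

text \<open>On the times from \<open>n\<close> to \<open>n + 1\<close> this interpolates between the
  preimages of the polydisc of radius \<open>\<rho>\<close> under \<open>E (N + n)\<close> and under
  \<open>E (N + n + 1)\<close>. The successor in \<open>stage\<close> keeps the index above
  \<open>N\<close>, as the estimates for \<open>T\<close> require.\<close>

definition \<Psi> :: "real \<Rightarrow> c2 \<Rightarrow> c2" where
  "\<Psi> t = T (stage t) (frac t) \<circ> E (stage t)"

lemma aut2_\<Psi>: "aut2 (\<Psi> t) (E_inv (stage t) \<circ> T_inv (stage t) (frac t))"
  unfolding \<Psi>_def by (intro aut2_compose aut2_E aut2_T) (auto simp: stage_def frac_ge_0)

lemma maxnorm_T_0_E: "maxnorm (T (Suc (N + n)) 0 (E (Suc (N + n)) p)) = maxnorm (E (N + n) p) / \<rho>"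
  by (simp add: E_Suc maxnorm_T_0)

text \<open>At \<open>t = n + 1\<close> the definition has already passed to the next stage, but
  both stages give \<open>maxnorm (E (N + n + 1) p) / \<rho>\<close> there. So each piece may be
  used on its closed interval.\<close>

lemma maxnorm_\<Psi>:
  assumes "real n \<le> t" "t \<le> real n + 1"
  shows "maxnorm (\<Psi> t p) = maxnorm (T (Suc (N + n)) (t - n) (E (Suc (N + n)) p))"
proof (cases "t = real n + 1")
  case True
  then have *: "frac t = 0" "stage t = Suc (N + Suc n)"
    by (auto simp: stage_def frac_def floor_add nat_add_distrib)
  show ?thesis
    unfolding \<Psi>_def comp_apply * using True maxnorm_T_0_E[of "Suc n" p] by (simp add: maxnorm_T_1)
next
  case False
  then have "\<lfloor>t\<rfloor> = int n" using assms by (simp add: floor_eq_iff)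
  then show ?thesis by (simp add: \<Psi>_def stage_def frac_def)
qed

lemma maxnorm_\<Psi>_of_nat: "maxnorm (\<Psi> (real n) p) = maxnorm (E (N + n) p) / \<rho>"
  using maxnorm_\<Psi>[of n "real n" p] maxnorm_T_0_E by simp

lemma maxnorm_\<Psi>_less_piece:
  assumes "real n \<le> t" "t < t'" "t' \<le> real n + 1" "maxnorm (\<Psi> t p) \<le> 1"
  shows "maxnorm (\<Psi> t' p) < 1"
  using assms maxnorm_\<Psi>[of n t p] maxnorm_\<Psi>[of n t' p]
    maxnorm_T_less[of "Suc (N + n)" "t - n" "t' - n" "E (Suc (N + n)) p"]
  by simp

text \<open>Strict growth on single pieces is chained through the integers between \<open>t\<close>
  and \<open>t'\<close>.\<close>

lemma maxnorm_\<Psi>_less: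
  assumes "0 \<le> t" "t < t'" "maxnorm (\<Psi> t p) \<le> 1"
  shows "maxnorm (\<Psi> t' p) < 1"
proof -
  have "t < t' \<Longrightarrow> t' \<le> real n \<Longrightarrow> maxnorm (\<Psi> t' p) < 1" for n t'
  proof (induction n arbitrary: t')
    case 0
    then show ?case using assms(1) by simp
  next
    case (Suc n)
    consider "t' \<le> real n" | "real n < t'" "real n \<le> t" | "real n < t'" "t < real n" by linarith
    then show ?case
    proof cases
      case 1
      then show ?thesis using Suc by blast
    next
      case 2
      then show ?thesis using Suc.prems assms(3) by (intro maxnorm_\<Psi>_less_piece[of n t]) auto
    next
      case 3
      then show ?thesis
        using Suc.prems Suc.IH[of "real n"] by (intro maxnorm_\<Psi>_less_piece[of n "real n"]) auto
    qed
  qed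
  then show ?thesis using real_nat_ceiling_ge assms(2) by blast
qed

lemma maxnorm_\<Psi>_left:
  assumes "0 < t" "maxnorm (\<Psi> t p) < 1"
  shows "\<exists>t'\<in>{0..<t}. maxnorm (\<Psi> t' p) < 1"
proof -
  \<comment> \<open>The ceiling puts an integer \<open>t\<close> at the right end of its piece,
    where there is room on the left.\<close>
  define n where "n = nat (\<lceil>t\<rceil> - 1)"
  have n: "real n < t" "t \<le> real n + 1"
    using assms(1) by (auto simp: n_def) linarith+
  obtain \<tau>' where "\<tau>' \<in> {0..<t - n}" "maxnorm (T (Suc (N + n)) \<tau>' (E (Suc (N + n)) p)) < 1"
    using continuous_less_left[OF continuous_on_maxnorm_T[of "Suc (N + n)"], of "t - n"]
      maxnorm_\<Psi>[of n t p] n assms(2) by fastforce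
  then show ?thesis
    using maxnorm_\<Psi>[of n "n + \<tau>'" p] n by (intro bexI[of _ "n + \<tau>'"]) auto
qed

lemma maxnorm_\<Psi>_right:
  assumes "0 \<le> t" "\<And>t'. t < t' \<Longrightarrow> maxnorm (\<Psi> t' p) < 1"
  shows "maxnorm (\<Psi> t p) \<le> 1"
proof -
  \<comment> \<open>The floor puts an integer \<open>t\<close> at the left end of its piece, where
    there is room on the right.\<close>
  define n where "n = nat \<lfloor>t\<rfloor>"
  have n: "real n \<le> t" "t < real n + 1"
    using assms(1) by (auto simp: n_def)
  have "maxnorm (T (Suc (N + n)) (t - n) (E (Suc (N + n)) p)) \<le> 1"
  proof (rule continuous_le_right[OF continuous_on_maxnorm_T])
    fix x assume "t - n < x" "x \<le> 1"
    then show "maxnorm (T (Suc (N + n)) x (E (Suc (N + n)) p)) < 1"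
      using maxnorm_\<Psi>[of n "n + x" p] assms(2)[of "n + x"] n by simp
  qed (use n in auto)
  then show ?thesis using maxnorm_\<Psi>[of n t p] n by simp
qed

lemma basin_eq_Union_\<Psi>: "basin H = (\<Union>t\<in>{0..}. \<Psi> t -` unit_polydisc2)"
proof
  show "basin H \<subseteq> (\<Union>t\<in>{0..}. \<Psi> t -` unit_polydisc2)"
  proof
    fix p assume "p \<in> basin H"
    then obtain m where m: "N \<le> m" "norm (E m p) < \<rho>"
      using eventually_happens[OF eventually_conj[OF eventually_ge_at_top[of N]
          basin_eventually_less[OF \<open>p \<in> basin H\<close> \<rho>_bounds(1)]]] by auto
    obtain n where n: "m = N + n" using m(1) le_Suc_ex by blast
    then have "maxnorm (\<Psi> (real n) p) < 1"
      using m(2) maxnorm_le_norm[of "E m p"] \<rho>_bounds by (simp add: maxnorm_\<Psi>_of_nat)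
    then show "p \<in> (\<Union>t\<in>{0..}. \<Psi> t -` unit_polydisc2)"
      by (intro UN_I[of "real n"]) (simp_all add: unit_polydisc2_eq)
  qed
  show "(\<Union>t\<in>{0..}. \<Psi> t -` unit_polydisc2) \<subseteq> basin H"
  proof
    fix p assume "p \<in> (\<Union>t\<in>{0..}. \<Psi> t -` unit_polydisc2)"
    then obtain t where t: "0 \<le> t" "maxnorm (\<Psi> t p) < 1" by (auto simp: unit_polydisc2_eq)
    obtain n where "t < real n" using reals_Archimedean2 by blast
    then have "maxnorm (\<Psi> (real n) p) < 1" using t maxnorm_\<Psi>_less[of t "real n" p] by simp
    then have "maxnorm (E (N + n) p) \<le> \<rho>"
      using \<rho>_bounds by (simp add: maxnorm_\<Psi>_of_nat)
    then show "p \<in> basin H" by (rule basinI[OF le_add1])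
  qed
qed

theorem loewner_short_C2_basin: "loewner_short_C2 (basin H)"
  unfolding loewner_short_C2_def
proof (intro conjI exI)
  note family = loewner_family[of \<Psi>, OF aut2_\<Psi> maxnorm_\<Psi>_less maxnorm_\<Psi>_left maxnorm_\<Psi>_right]
  let ?W = "\<lambda>t. \<Psi> t -` unit_polydisc2"
  show "short_C2 (basin H)" by (rule short_C2_basin)
  show "basin H = (\<Union>t\<in>{0..}. ?W t)" by (rule basin_eq_Union_\<Psi>)
  show "\<forall>t\<ge>0. domain2 (?W t)" by (rule family(1))
  show "(\<forall>t\<ge>0. biholomorphic2 (?W t) unit_ball2) \<or> (\<forall>t\<ge>0. biholomorphic2 (?W t) unit_polydisc2)"
    by (rule disjI2) (rule family(2))
  show "\<forall>t s. 0 \<le> t \<and> t < s \<longrightarrow> compact (closure (?W t)) \<and> closure (?W t) \<subseteq> ?W s"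
    by (rule family(3))
  show "\<forall>t>0. ?W t = (\<Union>t'\<in>{0..<t}. ?W t')" by (rule family(4))
  show "\<forall>t'\<ge>0. closure (?W t') = (\<Inter>t\<in>{t'<..}. ?W t)" by (rule family(5))
qed

end

theorem theorem1p4:
  fixes d :: nat and a :: "nat \<Rightarrow> real" and \<delta> :: "nat \<Rightarrow> complex"
    and q :: "nat \<Rightarrow> complex poly"
  assumes "d \<ge> 2"
    and "\<And>n. n \<ge> 1 \<Longrightarrow> 0 < a (Suc n) \<and> a (Suc n) \<le> a n \<and> a n < 1"
    and "\<And>n. n \<ge> 1 \<Longrightarrow> \<delta> n \<noteq> 0"
    and "\<And>n. n \<ge> 1 \<Longrightarrow> 1 \<le> degree (q n) \<and> degree (q n) \<le> d - 1"
    and "\<And>n i. n \<ge> 1 \<Longrightarrow> norm (coeff (q n) i) \<le> a n ^ (d ^ n)"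
    and "\<And>n. n \<ge> 1 \<Longrightarrow> norm (\<delta> n) \<le> a n ^ (d ^ n)"
  shows "loewner_short_C2 (basin (\<lambda>n. henonF d (q n) (\<delta> n)))"
proof -
  have a_bounds: "0 < a n \<and> a n \<le> a 1" if "n \<ge> 1" for n
    using that
  proof (induction n rule: dec_induct)
    case base
    then show ?case using assms(2)[of 1] by auto
  next
    case (step n)
    then show ?case using assms(2)[of n] by auto
  qed
  have pow: "a n ^ (d ^ n) \<le> a 1 ^ (d ^ n)" if "n \<ge> 1" for n
    using a_bounds[OF that] by (intro power_mono) auto
  interpret henon_sequence d "a 1" q \<delta>
  proof
    show "2 \<le> d" "0 < a 1" "a 1 < 1" using assms(1) assms(2)[of 1] by auto
    fix n :: nat assume n: "n \<ge> 1"
    show "\<delta> n \<noteq> 0" by (rule assms(3)[OF n])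
    show "norm (\<delta> n) \<le> a 1 ^ (d ^ n)" by (rule order_trans[OF assms(6)[OF n] pow[OF n]])
    show "norm (coeff (q n) i) \<le> a 1 ^ (d ^ n)" for i
      by (rule order_trans[OF assms(5)[OF n] pow[OF n]])
    show "degree (q n) < d" using assms(1) assms(4)[OF n] by linarith
  qed
  show ?thesis using loewner_short_C2_basin by (simp add: H_def[abs_def])
qed

end
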